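(* Let $T_1,\dots,T_k$ be rooted trees and let $T=B_+(T_1,\dots,T_k)$. Then the coefficient $\overline{\Omega}_{q,T}$ of $T$ in $\overline{\Omega}_q$ satisfies $$\overline{\Omega}_{q,T}=\Psi\Big(\prod_{i=1}^k \mathcal{S}_{T_i}\Big).$$
   Context: $q$ and $x$ are indeterminates. A tree is a finite rooted tree (finite connected acyclic graph with a distinguished vertex, the root), considered up to isomorphism. $\#T$ is the number of vertices of $T$, $\mathrm{aut}(T)$ is the order of its automorphism group, $\bullet$ is the one-vertex tree, and $B_+(T_1,\dots,T_k)$ is the tree obtained by grafting $T_1,\dots,T_k$ on a new common root (for $k=0$ this is $\bullet$). A tree series over a commutative $\mathbb{Q}$-algebra $R$ is a formal infinite sum $A=\sum_T A_T\,\frac{T}{\mathrm{aut}(T)}$ over all trees, with $A_T\in R$ (the coefficient of $T$ in $A$); $\bullet$ is also viewed as a tree series. For $\alpha\in R$, $(\Sigma_\alpha A)_T=\alpha^{\#T-1}A_T$. For tree series $A,B$, the tree series $\mathrm{Crls}\diamond(A,B)$ is defined by $$(\mathrm{Crls}\diamond(A,B))_T=\sum_{T_0}A_{T_0}\prod_{T'}B_{T'},$$ where $T_0$ runs over the subtrees (connected sets of vertices) of $T$ containing the root of $T$ (and rooted there), and $T'$ runs over the connected components of the complement of $T_0$ in $T$, each rooted at its vertex closest to the root of $T$ (an empty product is $1$). $\mathcal{S}$ denotes the unique tree series over $\mathbb{Q}(q)[x]$ satisfying $$q\,\Sigma_q \mathcal{S}-\mathrm{Crls}\diamond(\mathcal{S},-\bullet)=q\,(1+(q-1)x)\,\mathrm{Crls}\diamond(\bullet,\,q\,\Sigma_q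 \mathcal{S})-\bullet .$$ $\bullet\curvearrowleft A$ denotes the grafting of $A$ on the one-vertex tree (pre-Lie product): the coefficient of $B_+(T_1)$ in it is $A_{T_1}$, and the coefficient of any tree not of the form $B_+(T_1)$ is $0$. $\Omega_q$ is the tree series over $\mathbb{Q}(q)$ defined by the equation (which determines it uniquely) $$\mathrm{Crls}\diamond(q\,\Sigma_q\Omega_q,\bullet)-\Omega_q=\bullet\curvearrowleft\Omega_q+(q-1)\bullet ,$$ $\Omega_{1/q}$ is obtained from it by replacing $q$ by $1/q$ in all coefficients, and $\overline{\Omega}_q=\Sigma_{(-1/q)}\Omega_{1/q}$. The Bernoulli–Carlitz numbers $\beta_n\in\mathbb{Q}(q)$ are defined by $\beta_0=1$ and $q(q\beta+1)^n-\beta_n=1$ if $n=1$, $=0$ if $n>1$, where after expanding the binomial power each $\beta^k$ is replaced by $\beta_k$. $\Psi:\mathbb{Q}(q)[x]\to\mathbb{Q}(q)$ is the $\mathbb{Q}(q)$-linear form with $\Psi(x^n)=\beta_n$ for all $n\ge0$. *)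

theory Defs
  imports "HOL-Computational_Algebra.Computational_Algebra" "HOL-Computational_Algebra.Field_as_Ring"
    "HOL-Library.Nat_Bijection" "HOL-Library.Function_Algebras"
begin

section \<open>Finite rooted trees up to isomorphism\<close>

text \<open>Up to isomorphism, the vertices of a finite graph may be taken to be natural numbers.\<close>

datatype rgraph = RGraph (verts: "nat set") (edges: "nat set set") (root_vertex: nat)

definition adj :: "nat set set \<Rightarrow> nat set \<Rightarrow> (nat \<times> nat) set" where
  "adj E S = {(u, v). u \<in> S \<and> v \<in> S \<and> {u, v} \<in> E}"

definition connected_in :: "nat set set \<Rightarrow> nat set \<Rightarrow> bool" where
  "connected_in E S \<longleftrightarrow> S \<noteq> {} \<and> (\<forall>u\<in>S. \<forall>v\<in>S. (u, v) \<in> (adj E S)\<^sup>*)"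

definition components_in :: "nat set set \<Rightarrow> nat set \<Rightarrow> nat set set" where
  "components_in E S = (\<lambda>u. {v \<in> S. (u, v) \<in> (adj E S)\<^sup>*}) ` S"

definition is_cycle :: "nat set set \<Rightarrow> nat list \<Rightarrow> bool" where
  "is_cycle E vs \<longleftrightarrow> 3 \<le> length vs \<and> distinct vs \<and>
     (\<forall>i<length vs. {vs ! i, vs ! (Suc i mod length vs)} \<in> E)"

definition rooted_tree :: "rgraph \<Rightarrow> bool" where
  "rooted_tree G \<longleftrightarrow> finite (verts G) \<and> root_vertex G \<in> verts G \<and>
     (\<forall>e\<in>edges G. \<exists>u\<in>verts G. \<exists>v\<in>verts G. u \<noteq> v \<and> e = {u, v}) \<and>
     connected_in (edges G) (verts G) \<and> (\<nexists>vs. is_cycle (edges G) vs)"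

definition rooted_iso :: "(nat \<Rightarrow> nat) \<Rightarrow> rgraph \<Rightarrow> rgraph \<Rightarrow> bool" where
  "rooted_iso f G H \<longleftrightarrow> bij_betw f (verts G) (verts H) \<and> f (root_vertex G) = root_vertex H \<and>
     (\<forall>u\<in>verts G. \<forall>v\<in>verts G. {u, v} \<in> edges G \<longleftrightarrow> {f u, f v} \<in> edges H)"

definition rtree_rel :: "rgraph \<Rightarrow> rgraph \<Rightarrow> bool" where
  "rtree_rel G H \<longleftrightarrow> rooted_tree G \<and> rooted_tree H \<and> (\<exists>f. rooted_iso f G H)"

lemma rooted_tree_single: "rooted_tree (RGraph {a} {} a)"
  by (auto simp: rooted_tree_def connected_in_def is_cycle_def)
    (metis Suc_le_D Zero_not_Suc length_0_conv length_greater_0_conv numeral_3_eq_3)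

lemma rooted_iso_id: "rooted_iso id G G"
  by (simp add: rooted_iso_def)

lemma rooted_iso_comp:
  assumes "rooted_iso f G H" "rooted_iso g H K"
  shows "rooted_iso (g \<circ> f) G K"
proof -
  have "f u \<in> verts H" if "u \<in> verts G" for u
    using assms(1) that by (auto simp: rooted_iso_def bij_betw_def)
  then show ?thesis
    using assms by (auto simp: rooted_iso_def intro: bij_betw_trans)
qed

lemma rooted_iso_inv:
  assumes "rooted_iso f G H" "root_vertex G \<in> verts G"
  shows "rooted_iso (inv_into (verts G) f) H G"
proof -
  let ?g = "inv_into (verts G) f"
  have b: "bij_betw f (verts G) (verts H)" using assms(1) by (simp add: rooted_iso_def)
  have g: "?g v \<in> verts G \<and> f (?g v) = v" if "v \<in> verts H" for v
    using b that by (metis bij_betw_imp_surj_on f_inv_into_f inv_into_into)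
  have "?g (root_vertex H) = root_vertex G"
    using assms b by (metis bij_betw_inv_into_left rooted_iso_def)
  then show ?thesis
    using assms(1) g bij_betw_inv_into[OF b] by (auto simp: rooted_iso_def)
qed

quotient_type rtree = rgraph / partial: rtree_rel
proof (rule part_equivpI)
  show "\<exists>G. rtree_rel G G"
    using rooted_tree_single rooted_iso_id unfolding rtree_rel_def by blast
  show "symp rtree_rel"
    by (rule sympI) (metis rooted_iso_inv rooted_tree_def rtree_rel_def)
  show "transp rtree_rel"
    by (rule transpI) (metis rooted_iso_comp rtree_rel_def)
qed

definition tsize :: "rtree \<Rightarrow> nat" where
  "tsize T = card (verts (rep_rtree T))"

definition one_vertex :: rtree where
  "one_vertex = abs_rtree (RGraph {0} {} 0)"

text \<open>Vertex \<open>v\<close> of the \<open>i\<close>-th tree becomes \<open>tag_vertex i v\<close>; the new root is \<open>0\<close>.\<close>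

definition tag_vertex :: "nat \<Rightarrow> nat \<Rightarrow> nat" where
  "tag_vertex i v = Suc (prod_encode (i, v))"

definition grafted :: "rtree list \<Rightarrow> rgraph" where
  "grafted Ts = (let G = (\<lambda>i. rep_rtree (Ts ! i)) in RGraph
     (insert 0 (\<Union>i<length Ts. tag_vertex i ` verts (G i)))
     (\<Union>i<length Ts. insert {0, tag_vertex i (root_vertex (G i))} ((\<lambda>e. tag_vertex i ` e) ` edges (G i)))
     0)"

definition B_plus :: "rtree list \<Rightarrow> rtree" where
  "B_plus Ts = abs_rtree (grafted Ts)"

section \<open>Tree series\<close>

text \<open>A tree series \<open>\<Sum>\<^sub>T A\<^sub>T T / aut(T)\<close> is represented by its coefficient function \<open>T \<mapsto> A\<^sub>T\<close>;
  all operations are given on the coefficients \<open>A\<^sub>T\<close>, so \<open>aut\<close> does not appear.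
  Sums and differences of series are the pointwise ones.\<close>

type_synonym 'a tree_series = "rtree \<Rightarrow> 'a"

definition bullet :: "'a::comm_ring_1 tree_series" where
  "bullet T = (if T = one_vertex then 1 else 0)"

definition tscale :: "'a::comm_ring_1 \<Rightarrow> 'a tree_series \<Rightarrow> 'a tree_series" where
  "tscale c A T = c * A T"

definition suspension :: "'a::comm_ring_1 \<Rightarrow> 'a tree_series \<Rightarrow> 'a tree_series" where
  "suspension \<alpha> A T = \<alpha> ^ (tsize T - 1) * A T"

definition induced :: "rgraph \<Rightarrow> nat set \<Rightarrow> nat \<Rightarrow> rgraph" where
  "induced G S r = RGraph S {e \<in> edges G. e \<subseteq> S} r"

definition graph_dist :: "rgraph \<Rightarrow> nat \<Rightarrow> nat \<Rightarrow> nat" where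
  "graph_dist G u v = (LEAST n. (u, v) \<in> adj (edges G) (verts G) ^^ n)"

definition closest :: "rgraph \<Rightarrow> nat set \<Rightarrow> nat" where
  "closest G C = (ARG_MIN (graph_dist G (root_vertex G)) v. v \<in> C)"

definition Crls :: "'a::comm_ring_1 tree_series \<Rightarrow> 'a tree_series \<Rightarrow> 'a tree_series" where
  "Crls A B T = (let G = rep_rtree T in
     \<Sum>S | S \<subseteq> verts G \<and> root_vertex G \<in> S \<and> connected_in (edges G) S.
       A (abs_rtree (induced G S (root_vertex G))) *
       (\<Prod>C\<in>components_in (edges G) (verts G - S). B (abs_rtree (induced G C (closest G C)))))"

definition graft_bullet :: "'a::comm_ring_1 tree_series \<Rightarrow> 'a tree_series" where
  "graft_bullet A T =
     (if \<exists>T1. T = B_plus [T1] then A (THE T1. T = B_plus [T1]) else 0)"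

section \<open>The series \<open>\<S>\<close> and \<open>\<Omega>\<close>\<close>

type_synonym ratq = "rat poly fract"

text \<open>\<open>qq\<close> is the indeterminate of \<open>\<rat>(q)\<close>; the indeterminate \<open>x\<close> of \<open>\<rat>(q)[x]\<close> is \<open>[:0, 1:]\<close>.\<close>

definition qq :: ratq where
  "qq = to_fract [:0, 1:]"

definition is_S :: "ratq poly tree_series \<Rightarrow> bool" where
  "is_S S \<longleftrightarrow>
     tscale [:qq:] (suspension [:qq:] S) - Crls S (- bullet) =
     tscale ([:qq:] * (1 + ([:qq:] - 1) * [:0, 1:])) (Crls bullet (tscale [:qq:] (suspension [:qq:] S)))
       - bullet"

definition S_series :: "ratq poly tree_series" where
  "S_series = (THE S. is_S S)"

definition is_Omega :: "ratq tree_series \<Rightarrow> bool" where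
  "is_Omega W \<longleftrightarrow>
     Crls (tscale qq (suspension qq W)) bullet - W = graft_bullet W + tscale (qq - 1) bullet"

definition Omega :: "ratq tree_series" where
  "Omega = (THE W. is_Omega W)"

text \<open>Substitution of \<open>1/q\<close> for \<open>q\<close>.\<close>

definition inv_q :: "ratq \<Rightarrow> ratq" where
  "inv_q f = (case quot_of_fract f of (a, b) \<Rightarrow>
     poly (map_poly (\<lambda>c. to_fract [:c:]) a) (1 / qq) /
     poly (map_poly (\<lambda>c. to_fract [:c:]) b) (1 / qq))"

definition Omega_bar :: "ratq tree_series" where
  "Omega_bar = suspension (- 1 / qq) (\<lambda>T. inv_q (Omega T))"

section \<open>Bernoulli--Carlitz numbers\<close>

definition is_bernoulli_carlitz :: "(nat \<Rightarrow> ratq) \<Rightarrow> bool" where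
  "is_bernoulli_carlitz b \<longleftrightarrow> b 0 = 1 \<and>
     (\<forall>n\<ge>1. qq * (\<Sum>k\<le>n. of_nat (n choose k) * qq ^ k * b k) - b n = (if n = 1 then 1 else 0))"

definition bernoulli_carlitz :: "nat \<Rightarrow> ratq" where
  "bernoulli_carlitz = (THE b. is_bernoulli_carlitz b)"

text \<open>See \<open>Psi_linear\<close> and \<open>Psi_power\<close> below.\<close>

definition Psi :: "ratq poly \<Rightarrow> ratq" where
  "Psi p = (\<Sum>n\<le>degree p. coeff p n * bernoulli_carlitz n)"

section \<open>The definite descriptions are well defined\<close>

lemma rtree_relD: "rtree_rel G G \<longleftrightarrow> rooted_tree G"
  using rooted_iso_id by (auto simp: rtree_rel_def)

lemma rooted_tree_rep [simp]: "rooted_tree (rep_rtree T)"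
  using Quotient3_rep_reflp[OF Quotient3_rtree] by (simp add: rtree_relD)

lemma abs_rep_rtree [simp]: "abs_rtree (rep_rtree T) = T"
  using Quotient3_abs_rep[OF Quotient3_rtree] .

lemma rtree_rel_rep_abs: "rooted_tree G \<Longrightarrow> rtree_rel (rep_rtree (abs_rtree G)) G"
  using rep_abs_rsp_left[OF Quotient3_rtree, of G G] by (simp add: rtree_relD)

lemma abs_rtree_eq_iff:
  "rooted_tree G \<Longrightarrow> rooted_tree H \<Longrightarrow> abs_rtree G = abs_rtree H \<longleftrightarrow> (\<exists>f. rooted_iso f G H)"
  using Quotient3_rel[OF Quotient3_rtree, of G H] by (auto simp: rtree_relD rtree_rel_def)

lemma tsize_abs: "rooted_tree G \<Longrightarrow> tsize (abs_rtree G) = card (verts G)"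
  using rtree_rel_rep_abs[of G] bij_betw_same_card
  by (auto simp: tsize_def rtree_rel_def rooted_iso_def)

lemma finite_verts_rep [simp]: "finite (verts (rep_rtree T))"
  using rooted_tree_rep[of T] unfolding rooted_tree_def by blast

lemma root_rep [simp]: "root_vertex (rep_rtree T) \<in> verts (rep_rtree T)"
  using rooted_tree_rep[of T] unfolding rooted_tree_def by blast

lemma tsize_pos [simp]: "0 < tsize T"
  unfolding tsize_def by (metis card_gt_0_iff empty_iff finite_verts_rep root_rep)

lemma adj_induced: "adj {e \<in> E. e \<subseteq> S} S = adj E S"
  by (auto simp: adj_def)

lemma rooted_tree_induced:
  assumes "rooted_tree G" "S \<subseteq> verts G" "r \<in> S" "connected_in (edges G) S"
  shows "rooted_tree (induced G S r)"
proof -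
  have "is_cycle (edges G) vs" if "is_cycle {e \<in> edges G. e \<subseteq> S} vs" for vs
    using that by (auto simp: is_cycle_def)
  moreover have "\<exists>u\<in>S. \<exists>v\<in>S. u \<noteq> v \<and> e = {u, v}" if "e \<in> edges G" "e \<subseteq> S" for e
    using assms(1) that unfolding rooted_tree_def by fastforce
  ultimately show ?thesis
    using assms finite_subset[OF assms(2)]
    by (auto simp: rooted_tree_def induced_def connected_in_def adj_induced)
qed

lemma sym_adj: "sym (adj E S)"
  by (auto simp: adj_def sym_def insert_commute)

lemma components_inE:
  assumes "C \<in> components_in E S"
  shows "C \<subseteq> S" "connected_in E C"
proof -
  obtain u where u: "u \<in> S" and C: "C = {v \<in> S. (u, v) \<in> (adj E S)\<^sup>*}"
    using assms by (auto simp: components_in_def)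
  show "C \<subseteq> S" using C by blast
  have *: "(u, v) \<in> (adj E C)\<^sup>*" if "(u, v) \<in> (adj E S)\<^sup>*" for v
    using that
  proof (induction rule: rtrancl_induct)
    case (step y z)
    have "y \<in> S" "z \<in> S" using step(2) by (auto simp: adj_def)
    moreover have "(u, z) \<in> (adj E S)\<^sup>*" using step(1,2) by (rule rtrancl_into_rtrancl)
    ultimately have "(y, z) \<in> adj E C" using step(1,2) by (auto simp: C adj_def)
    then show ?case using step.IH by (rule rtrancl_into_rtrancl[rotated])
  qed simp
  have "(v, w) \<in> (adj E C)\<^sup>*" if "v \<in> C" "w \<in> C" for v w
  proof -
    have "(u, v) \<in> (adj E C)\<^sup>*" "(u, w) \<in> (adj E C)\<^sup>*" using that * C by auto
    then show ?thesis
      by (meson rtrancl_trans symD sym_rtrancl sym_adj)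
  qed
  moreover have "u \<in> C" using u C by simp
  ultimately show "connected_in E C" by (auto simp: connected_in_def)
qed

lemma components_in_empty [simp]: "components_in E {} = {}"
  by (simp add: components_in_def)

lemma closest_in: "C \<noteq> {} \<Longrightarrow> closest G C \<in> C"
  unfolding closest_def by (metis arg_min_natI ex_in_conv)

lemma induced_all: "rooted_tree G \<Longrightarrow> induced G (verts G) (root_vertex G) = G"
  by (cases G) (auto simp: induced_def rooted_tree_def)

lemma Crls_cong_right:
  assumes "\<And>T'. tsize T' < tsize T \<Longrightarrow> B T' = B' T'"
  shows "Crls A B T = Crls A B' T"
proof -
  define G where "G = rep_rtree T"
  have G: "rooted_tree G" by (simp add: G_def)
  have "B (abs_rtree (induced G C (closest G C))) = B' (abs_rtree (induced G C (closest G C)))"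
    if S: "root_vertex G \<in> S" and C: "C \<in> components_in (edges G) (verts G - S)" for S C
  proof (rule assms)
    note C' = components_inE[OF C]
    have "rooted_tree (induced G C (closest G C))"
      using C' by (intro rooted_tree_induced G closest_in) (auto simp: connected_in_def)
    then have "tsize (abs_rtree (induced G C (closest G C))) = card C"
      by (simp add: tsize_abs induced_def)
    also have "\<dots> < card (verts G)"
      using C' S by (intro psubset_card_mono) (auto simp: G_def)
    finally show "tsize (abs_rtree (induced G C (closest G C))) < tsize T"
      by (simp add: tsize_def G_def)
  qed
  then show ?thesis
    unfolding Crls_def Let_def G_def[symmetric]
    by (intro sum.cong refl arg_cong2[where f = "(*)"] prod.cong) auto
qed

definition Crls_lower :: "'a::comm_ring_1 tree_series \<Rightarrow> 'a tree_series \<Rightarrow> 'a tree_series" where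
  "Crls_lower A B T = (let G = rep_rtree T in
     \<Sum>S | S \<subset> verts G \<and> root_vertex G \<in> S \<and> connected_in (edges G) S.
       A (abs_rtree (induced G S (root_vertex G))) *
       (\<Prod>C\<in>components_in (edges G) (verts G - S). B (abs_rtree (induced G C (closest G C)))))"

lemma Crls_split: "Crls A B T = A T + Crls_lower A B T"
proof -
  define G where "G = rep_rtree T"
  have G: "rooted_tree G" by (simp add: G_def)
  have "{S. S \<subseteq> verts G \<and> root_vertex G \<in> S \<and> connected_in (edges G) S} =
    insert (verts G) {S. S \<subset> verts G \<and> root_vertex G \<in> S \<and> connected_in (edges G) S}"
    using G by (auto simp: rooted_tree_def)
  moreover have "finite {S. S \<subset> verts G \<and> root_vertex G \<in> S \<and> connected_in (edges G) S}"
    by (rule finite_subset[of _ "Pow (verts G)"]) (auto simp: G_def)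
  ultimately show ?thesis
    unfolding Crls_def Crls_lower_def Let_def G_def[symmetric]
    by (simp add: induced_all[OF G]) (simp add: G_def)
qed

lemma Crls_lower_cong:
  assumes "\<And>T'. tsize T' < tsize T \<Longrightarrow> A T' = A' T'"
  shows "Crls_lower A B T = Crls_lower A' B T"
proof -
  define G where "G = rep_rtree T"
  have G: "rooted_tree G" by (simp add: G_def)
  have "A (abs_rtree (induced G S (root_vertex G))) = A' (abs_rtree (induced G S (root_vertex G)))"
    if "S \<subset> verts G" "root_vertex G \<in> S" "connected_in (edges G) S" for S
  proof (rule assms)
    have "tsize (abs_rtree (induced G S (root_vertex G))) = card S"
      using rooted_tree_induced[OF G _ that(2,3)] that(1) by (auto simp: tsize_abs induced_def)
    also have "\<dots> < card (verts G)"
      using that(1) by (intro psubset_card_mono) (auto simp: G_def)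
    finally show "tsize (abs_rtree (induced G S (root_vertex G))) < tsize T"
      by (simp add: tsize_def G_def)
  qed
  then show ?thesis
    unfolding Crls_lower_def Let_def G_def[symmetric]
    by (intro sum.cong refl arg_cong2[where f = "(*)"]) auto
qed

lemma ex1_wf_nat:
  fixes F :: "'t \<Rightarrow> ('t \<Rightarrow> 'a) \<Rightarrow> 'a" and m :: "'t \<Rightarrow> nat"
  assumes F: "\<And>T A B. (\<And>T'. m T' < m T \<Longrightarrow> A T' = B T') \<Longrightarrow> F T A = F T B"
  shows "\<exists>!A. \<forall>T. A T = F T A"
proof (rule ex_ex1I)
  let ?A = "wfrec (measure m) (\<lambda>f T. F T f)"
  have "?A T = F T (cut ?A (measure m) T)" for T
    by (rule wfrec[OF wf_measure])
  also have "F T (cut ?A (measure m) T) = F T ?A" for T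
    by (rule F) (simp add: cut_apply)
  finally show "\<exists>A. \<forall>T. A T = F T A" by blast
next
  fix A B assume A: "\<forall>T. A T = F T A" and B: "\<forall>T. B T = F T B"
  have "A T = B T" for T
  proof (induction "m T" arbitrary: T rule: less_induct)
    case less
    then have "F T A = F T B" by (intro F) auto
    then show ?case using A B by metis
  qed
  then show "A = B" by blast
qed

lemma qq_power_neq_1: "0 < n \<Longrightarrow> qq ^ n - 1 \<noteq> 0"
proof -
  assume n: "0 < n"
  have "qq ^ n = to_fract (monom 1 n)"
    by (induction n) (simp_all add: qq_def monom_0 monom_Suc one_pCons[symmetric] flip: to_fract_mult to_fract_1)
  moreover have "monom (1::rat) n \<noteq> 1"
    using n by (metis degree_1 degree_monom_eq less_irrefl one_neq_zero)
  ultimately show ?thesis by (metis eq_iff_diff_eq_0 to_fract_1 to_fract_eq_iff)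
qed

lemma ex1_bernoulli_carlitz: "\<exists>!b. is_bernoulli_carlitz b"
proof -
  define F where "F = (\<lambda>n (b :: nat \<Rightarrow> ratq). if n = 0 then 1 else
    ((if n = 1 then 1 else 0) - qq * (\<Sum>k<n. of_nat (n choose k) * qq ^ k * b k)) / (qq ^ Suc n - 1))"
  have "is_bernoulli_carlitz b \<longleftrightarrow> (\<forall>n. b n = F n b)" for b
  proof -
    have "qq * (\<Sum>k\<le>n. of_nat (n choose k) * qq ^ k * b k) - b n = c \<longleftrightarrow>
        b n = (c - qq * (\<Sum>k<n. of_nat (n choose k) * qq ^ k * b k)) / (qq ^ Suc n - 1)" for n c
      using qq_power_neq_1[of "Suc n"]
      by (auto simp: lessThan_Suc_atMost[symmetric] field_simps simp del: lessThan_Suc_atMost power_Suc)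
        (auto simp: algebra_simps)
    then have "is_bernoulli_carlitz b \<longleftrightarrow> b 0 = F 0 b \<and> (\<forall>n\<ge>1. b n = F n b)"
      unfolding is_bernoulli_carlitz_def F_def by auto
    also have "\<dots> \<longleftrightarrow> (\<forall>n. b n = F n b)"
      by (metis less_one linorder_not_le)
    finally show ?thesis .
  qed
  moreover have "\<exists>!b. \<forall>n. b n = F n b"
    by (rule ex1_wf_nat[where m = id]) (auto simp: F_def)
  ultimately show ?thesis by simp
qed

lemma ex1_S: "\<exists>!S. is_S S"
proof -
  define X where "X = (\<lambda>S. tscale [:qq:] (suspension [:qq:] S) :: ratq poly tree_series)"
  define F where "F = (\<lambda>T S. smult (1 / (qq ^ tsize T - 1))
    (([:qq:] * (1 + ([:qq:] - 1) * [:0, 1:])) * Crls bullet (X S) T - bullet T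
      + Crls_lower S (- bullet) T))"
  have X: "X S T = [:qq ^ tsize T:] * S T" for S T
    by (cases "tsize T") (use tsize_pos[of T] in
      \<open>auto simp: X_def tscale_def suspension_def poly_const_pow mult_ac\<close>)
  have "is_S S \<longleftrightarrow> (\<forall>T. S T = F T S)" for S
  proof -
    have *: "smult a s - (s + l) = r \<longleftrightarrow> s = smult (1 / (a - 1)) (r + l)"
      if "a - 1 \<noteq> 0" for a :: ratq and s l r
    proof -
      have "smult a s - (s + l) = r \<longleftrightarrow> smult (a - 1) s = r + l"
        by (auto simp: algebra_simps smult_diff_left)
      also have "\<dots> \<longleftrightarrow> s = smult (1 / (a - 1)) (r + l)"
      proof -
        have "smult (1 / (a - 1)) (smult (a - 1) s) = s"
          "smult (a - 1) (smult (1 / (a - 1)) (r + l)) = r + l" using that by simp_all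
        then show ?thesis by metis
      qed
      finally show ?thesis .
    qed
    have "is_S S \<longleftrightarrow> (\<forall>T. X S T - Crls S (- bullet) T =
       ([:qq:] * (1 + ([:qq:] - 1) * [:0, 1:])) * Crls bullet (X S) T - bullet T)"
      unfolding is_S_def fun_eq_iff X_def by (simp only: minus_apply tscale_def)
    also have "\<dots> \<longleftrightarrow> (\<forall>T. S T = F T S)"
      unfolding X Crls_split[of S] F_def
      using *[OF qq_power_neq_1[OF tsize_pos]] by simp
    finally show ?thesis .
  qed
  moreover have "\<exists>!S. \<forall>T. S T = F T S"
  proof (rule ex1_wf_nat[where m = tsize])
    fix T and A B :: "ratq poly tree_series"
    assume AB: "\<And>T'. tsize T' < tsize T \<Longrightarrow> A T' = B T'"
    have "Crls_lower A (- bullet) T = Crls_lower B (- bullet) T"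
      by (rule Crls_lower_cong) (rule AB)
    moreover have "Crls bullet (X A) T = Crls bullet (X B) T"
      by (rule Crls_cong_right) (simp add: X AB)
    ultimately show "F T A = F T B" by (simp add: F_def)
  qed
  ultimately show ?thesis by simp
qed


lemma tag_vertex_simps [simp]:
  "tag_vertex i v = tag_vertex j w \<longleftrightarrow> i = j \<and> v = w" "tag_vertex i v \<noteq> 0" "0 \<noteq> tag_vertex i v"
  by (auto simp: tag_vertex_def)

lemma inj_tag_vertex [simp]: "inj (tag_vertex i)"
  by (simp add: inj_def)

lemma tag_image_eq_iff [simp]: "tag_vertex i ` e = tag_vertex i ` e' \<longleftrightarrow> e = e'"
  by (simp add: inj_image_eq_iff)

lemma edges_rep: "e \<in> edges (rep_rtree T) \<Longrightarrow>
    \<exists>u\<in>verts (rep_rtree T). \<exists>v\<in>verts (rep_rtree T). u \<noteq> v \<and> e = {u, v}"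
  using rooted_tree_rep[of T] unfolding rooted_tree_def by blast

lemma edges_grafted_iff:
  "x \<in> edges (grafted Ts) \<longleftrightarrow> (\<exists>i<length Ts.
     x = {0, tag_vertex i (root_vertex (rep_rtree (Ts ! i)))} \<or>
     (\<exists>e\<in>edges (rep_rtree (Ts ! i)). x = tag_vertex i ` e))"
  by (auto simp: grafted_def Let_def)

lemma edge_tag_tag:
  "{tag_vertex i u, tag_vertex j v} \<in> edges (grafted Ts) \<longleftrightarrow>
     i < length Ts \<and> j = i \<and> {u, v} \<in> edges (rep_rtree (Ts ! i))"
proof
  assume "{tag_vertex i u, tag_vertex j v} \<in> edges (grafted Ts)"
  then obtain k where k: "k < length Ts" and
    "{tag_vertex i u, tag_vertex j v} = {0, tag_vertex k (root_vertex (rep_rtree (Ts ! k)))} \<or>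
     (\<exists>e\<in>edges (rep_rtree (Ts ! k)). {tag_vertex i u, tag_vertex j v} = tag_vertex k ` e)"
    unfolding edges_grafted_iff by blast
  moreover have "{tag_vertex i u, tag_vertex j v} \<noteq> {0, w}" for w
    by (metis insertI1 insertE singletonD tag_vertex_simps(3))
  ultimately obtain e where e: "e \<in> edges (rep_rtree (Ts ! k))"
    and eq: "{tag_vertex i u, tag_vertex j v} = tag_vertex k ` e" by blast
  have "tag_vertex i u \<in> tag_vertex k ` e" "tag_vertex j v \<in> tag_vertex k ` e"
    unfolding eq[symmetric] by simp_all
  then have ij: "i = k" "j = k" by auto
  have "tag_vertex k ` {u, v} = tag_vertex k ` e" using eq ij by simp
  then have "{u, v} = e" by (simp only: tag_image_eq_iff)
  then show "i < length Ts \<and> j = i \<and> {u, v} \<in> edges (rep_rtree (Ts ! i))"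
    using e ij k by simp
next
  assume *: "i < length Ts \<and> j = i \<and> {u, v} \<in> edges (rep_rtree (Ts ! i))"
  have "{tag_vertex i u, tag_vertex i v} = tag_vertex i ` {u, v}" by simp
  then show "{tag_vertex i u, tag_vertex j v} \<in> edges (grafted Ts)"
    unfolding edges_grafted_iff using * by blast
qed

lemma edge_zero:
  "{0, w} \<in> edges (grafted Ts) \<longleftrightarrow>
     (\<exists>i<length Ts. w = tag_vertex i (root_vertex (rep_rtree (Ts ! i))))"
proof -
  have "{0, w} \<noteq> tag_vertex k ` e" for k e
  proof
    assume "{0, w} = tag_vertex k ` e"
    then have "0 \<in> tag_vertex k ` e" by auto
    then show False by auto
  qed
  then show ?thesis by (auto simp: grafted_def Let_def doubleton_eq_iff)
qed

lemma verts_grafted: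
  "w \<in> verts (grafted Ts) \<longleftrightarrow>
    w = 0 \<or> (\<exists>i<length Ts. \<exists>v\<in>verts (rep_rtree (Ts ! i)). w = tag_vertex i v)"
  by (auto simp: grafted_def Let_def)

lemma edges_grafted:
  assumes "e \<in> edges (grafted Ts)"
  shows "\<exists>u\<in>verts (grafted Ts). \<exists>v\<in>verts (grafted Ts). u \<noteq> v \<and> e = {u, v}"
proof -
  obtain i where i: "i < length Ts" and e: "e = {0, tag_vertex i (root_vertex (rep_rtree (Ts ! i)))} \<or>
      e \<in> (\<lambda>e. tag_vertex i ` e) ` edges (rep_rtree (Ts ! i))"
    using assms by (auto simp: grafted_def Let_def)
  from e show ?thesis
  proof
    assume "e = {0, tag_vertex i (root_vertex (rep_rtree (Ts ! i)))}"
    then show ?thesis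
      using i root_rep[of "Ts ! i"] tag_vertex_simps(3) by (metis verts_grafted)
  next
    assume "e \<in> (\<lambda>e. tag_vertex i ` e) ` edges (rep_rtree (Ts ! i))"
    then obtain u v where "u \<in> verts (rep_rtree (Ts ! i))" "v \<in> verts (rep_rtree (Ts ! i))"
      "u \<noteq> v" "e = {tag_vertex i u, tag_vertex i v}"
      using edges_rep by fastforce
    then show ?thesis
      using i by (metis tag_vertex_simps(1) verts_grafted)
  qed
qed

lemma connected_grafted: "connected_in (edges (grafted Ts)) (verts (grafted Ts))"
proof -
  let ?R = "(adj (edges (grafted Ts)) (verts (grafted Ts)))\<^sup>*"
  have 0: "(0, w) \<in> ?R" if w: "w \<in> verts (grafted Ts)" for w
  proof (cases "w = 0")
    case False
    then obtain i v where i: "i < length Ts" and v: "v \<in> verts (rep_rtree (Ts ! i))"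
      and [simp]: "w = tag_vertex i v"
      using w by (auto simp: verts_grafted)
    let ?G = "rep_rtree (Ts ! i)"
    have "(root_vertex ?G, v) \<in> (adj (edges ?G) (verts ?G))\<^sup>*"
      using rooted_tree_rep[of "Ts ! i"] v by (auto simp: rooted_tree_def connected_in_def)
    then have "(tag_vertex i (root_vertex ?G), tag_vertex i v) \<in> ?R"
    proof (induction rule: rtrancl_induct)
      case (step y z)
      then have "(tag_vertex i y, tag_vertex i z) \<in> adj (edges (grafted Ts)) (verts (grafted Ts))"
        using i by (auto simp: adj_def edge_tag_tag verts_grafted)
      with step.IH show ?case by (rule rtrancl_into_rtrancl)
    qed simp
    moreover have "(0, tag_vertex i (root_vertex ?G)) \<in> adj (edges (grafted Ts)) (verts (grafted Ts))"
      using i root_rep[of "Ts ! i"] by (auto simp: adj_def edge_zero verts_grafted)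
    ultimately show ?thesis by (simp add: converse_rtrancl_into_rtrancl)
  qed simp
  have "(u, v) \<in> ?R" if "u \<in> verts (grafted Ts)" "v \<in> verts (grafted Ts)" for u v
    using 0[OF that(1)] 0[OF that(2)] by (meson rtrancl_trans symD sym_rtrancl sym_adj)
  then show ?thesis by (auto simp: connected_in_def verts_grafted)
qed

lemma is_cycle_rotate:
  assumes "is_cycle E vs"
  shows "is_cycle E (rotate n vs)"
proof -
  have "{rotate n vs ! i, rotate n vs ! (Suc i mod length vs)} \<in> E" if "i < length vs" for i
  proof -
    let ?l = "length vs"
    have l: "0 < ?l" using assms by (auto simp: is_cycle_def)
    have "rotate n vs ! i = vs ! ((n + i) mod ?l)" using that by (simp add: nth_rotate)
    moreover have "rotate n vs ! (Suc i mod ?l) = vs ! ((n + Suc i mod ?l) mod ?l)"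
      using l by (simp add: nth_rotate)
    moreover have "(n + Suc i mod ?l) mod ?l = Suc ((n + i) mod ?l) mod ?l"
      by (simp add: mod_simps)
    ultimately show ?thesis
      using assms l by (auto simp: is_cycle_def)
  qed
  then show ?thesis using assms by (simp add: is_cycle_def)
qed

lemma acyclic_grafted: "\<not> is_cycle (edges (grafted Ts)) vs"
proof
  let ?E = "edges (grafted Ts)"
  assume cyc: "is_cycle ?E vs"
  define tag where "tag = (\<lambda>w. fst (prod_decode (w - 1)))"
  have tag [simp]: "tag (tag_vertex i v) = i" for i v by (simp add: tag_def tag_vertex_def)
  have tag_eq: "tag u = tag v" if uv: "{u, v} \<in> ?E" "u \<noteq> 0" "v \<noteq> 0" for u v
  proof -
    obtain a b where "u = tag_vertex (fst a) (snd a)" "v = tag_vertex (fst b) (snd b)"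
      using uv(2,3) by (metis Suc_pred neq0_conv prod.collapse prod_decode_inverse tag_vertex_def)
    then show ?thesis using uv(1) by (simp add: edge_tag_tag)
  qed
  show False
  proof (cases "0 \<in> set vs")
    case True
    then obtain n where n: "n < length vs" "vs ! n = 0" by (auto simp: in_set_conv_nth)
    define ws where "ws = rotate n vs"
    have ws: "is_cycle ?E ws" using is_cycle_rotate[OF cyc] by (simp add: ws_def)
    have ws0: "ws ! 0 = 0" using n nth_rotate[of 0 vs n] by (cases vs) (auto simp: ws_def)
    let ?l = "length ws"
    have l: "3 \<le> ?l" and dist: "distinct ws"
      and edge: "\<And>i. i < ?l \<Longrightarrow> {ws ! i, ws ! (Suc i mod ?l)} \<in> ?E"
      using ws by (auto simp: is_cycle_def)
    have nz: "ws ! i \<noteq> 0" if "0 < i" "i < ?l" for i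
      using dist ws0 that by (metis gr_implies_not0 nth_eq_iff_index_eq length_greater_0_conv list.size(3))
    have t: "tag (ws ! Suc i) = tag (ws ! 1)" if "Suc i < ?l" for i
      using that
    proof (induction i)
      case (Suc i)
      then show ?case using tag_eq[OF _ nz[of "Suc i"] nz[of "Suc (Suc i)"]] edge[of "Suc i"] by simp
    qed simp
    have "{0, ws ! 1} \<in> ?E" 
    proof -
      have "0 < ?l" "Suc 0 mod ?l = 1" using l by auto
      then show ?thesis using edge[of 0] ws0 by metis
    qed
    then obtain i where i: "ws ! 1 = tag_vertex i (root_vertex (rep_rtree (Ts ! i)))"
      by (auto simp: edge_zero)
    have "{0, ws ! (?l - 1)} \<in> ?E"
    proof -
      have "?l - 1 < ?l" "Suc (?l - 1) = ?l" using l by auto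
      then show ?thesis using edge[of "?l - 1"] ws0 by (metis insert_commute mod_self)
    qed
    then obtain j where j: "ws ! (?l - 1) = tag_vertex j (root_vertex (rep_rtree (Ts ! j)))"
      by (auto simp: edge_zero)
    have "i = j" using t[of "?l - 2"] l i j by (simp add: numeral_2_eq_2 Suc_diff_Suc)
    then have "ws ! 1 = ws ! (?l - 1)" using i j by simp
    then show False using dist l by (simp add: nth_eq_iff_index_eq)
  next
    case False
    let ?l = "length vs"
    have l: "3 \<le> ?l" and dist: "distinct vs"
      and edge: "\<And>i. i < ?l \<Longrightarrow> {vs ! i, vs ! (Suc i mod ?l)} \<in> ?E"
      using cyc by (auto simp: is_cycle_def)
    have nz: "vs ! i \<noteq> 0" if "i < ?l" for i using False that by (metis nth_mem)
    define k where "k = tag (vs ! 0)"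
    have t: "tag (vs ! i) = k" if "i < ?l" for i
      using that
    proof (induction i)
      case (Suc i)
      then show ?case using tag_eq[OF _ nz[of i] nz[of "Suc i"]] edge[of i] by simp
    qed (simp add: k_def)
    define us where "us = map (\<lambda>w. snd (prod_decode (w - 1))) vs"
    have vs: "vs ! i = tag_vertex k (us ! i)" if "i < ?l" for i
      using t[OF that] nz[OF that] that
      by (simp add: us_def tag_def tag_vertex_def) (metis Suc_pred prod.collapse prod_decode_inverse)
    have "k < length Ts \<and> {us ! i, us ! (Suc i mod ?l)} \<in> edges (rep_rtree (Ts ! k))" if "i < ?l" for i
    proof -
      have "Suc i mod ?l < ?l" using that by (intro mod_less_divisor) linarith
      then show ?thesis using edge[OF that] vs[OF that] vs[of "Suc i mod ?l"] by (simp add: edge_tag_tag)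
    qed
    moreover have "distinct us"
    proof -
      have "length us = ?l" by (simp add: us_def)
      moreover have "us ! i \<noteq> us ! j" if "i < ?l" "j < ?l" "i \<noteq> j" for i j
        using nth_eq_iff_index_eq[OF dist that(1,2)] vs[OF that(1)] vs[OF that(2)] that(3) by metis
      ultimately show ?thesis by (simp add: distinct_conv_nth)
    qed
    ultimately have "is_cycle (edges (rep_rtree (Ts ! k))) us"
      using l by (simp add: is_cycle_def us_def)
    then show False using rooted_tree_rep[of "Ts ! k"] unfolding rooted_tree_def by blast
  qed
qed

lemma rooted_tree_grafted: "rooted_tree (grafted Ts)"
  unfolding rooted_tree_def
  using edges_grafted connected_grafted acyclic_grafted
  by (auto simp: grafted_def Let_def)

lemma tsize_B_plus_single: "tsize (B_plus [T]) = Suc (tsize T)"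
proof -
  have "verts (grafted [T]) = insert 0 (tag_vertex 0 ` verts (rep_rtree T))"
    by (simp add: grafted_def lessThan_Suc)
  moreover have "card (tag_vertex 0 ` verts (rep_rtree T)) = tsize T"
    unfolding tsize_def by (intro card_image) (auto simp: inj_on_def)
  ultimately show ?thesis
    by (simp add: B_plus_def tsize_abs rooted_tree_grafted card_insert_disjoint image_iff)
qed

lemma B_plus_single_inject:
  assumes "B_plus [T] = B_plus [T']"
  shows "T = T'"
proof -
  let ?G = "rep_rtree T" and ?H = "rep_rtree T'"
  obtain f where f: "rooted_iso f (grafted [T]) (grafted [T'])"
    using assms by (auto simp: B_plus_def abs_rtree_eq_iff rooted_tree_grafted)
  have r0: "root_vertex (grafted Ts) = 0" for Ts by (simp add: grafted_def Let_def)
  have b: "bij_betw f (verts (grafted [T])) (verts (grafted [T']))"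
    and f0: "f 0 = 0"
    and fe: "\<And>u v. u \<in> verts (grafted [T]) \<Longrightarrow> v \<in> verts (grafted [T]) \<Longrightarrow>
      {u, v} \<in> edges (grafted [T]) \<longleftrightarrow> {f u, f v} \<in> edges (grafted [T'])"
    using f unfolding rooted_iso_def r0 by blast+
  have V: "verts (grafted [T]) = insert 0 (tag_vertex 0 ` verts (rep_rtree T))" for T
    by (simp add: grafted_def lessThan_Suc)
  define g where "g = (\<lambda>u. snd (prod_decode (f (tag_vertex 0 u) - 1)))"
  have g: "f (tag_vertex 0 u) = tag_vertex 0 (g u) \<and> g u \<in> verts ?H" if u: "u \<in> verts ?G" for u
  proof -
    have "f (tag_vertex 0 u) \<in> verts (grafted [T'])" "f (tag_vertex 0 u) \<noteq> f 0"
      using b u by (auto simp: bij_betw_def V inj_on_def)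
    then show ?thesis using f0 by (auto simp: V g_def tag_vertex_def)
  qed
  have "inj_on g (verts ?G)"
  proof (rule inj_onI)
    fix u v assume uv: "u \<in> verts ?G" "v \<in> verts ?G" "g u = g v"
    then have "f (tag_vertex 0 u) = f (tag_vertex 0 v)" using g by simp
    then have "tag_vertex 0 u = tag_vertex 0 v"
      using b uv(1,2) by (auto simp: bij_betw_def V dest: inj_onD)
    then show "u = v" by simp
  qed
  moreover have "w \<in> g ` verts ?G" if w: "w \<in> verts ?H" for w
  proof -
    have "tag_vertex 0 w \<in> f ` verts (grafted [T])"
      using b w by (auto simp: bij_betw_def V)
    then obtain u where "u \<in> verts ?G" "f (tag_vertex 0 u) = tag_vertex 0 w"
      using f0 by (auto simp: V)
    then show ?thesis using g[of u] by auto
  qed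
  ultimately have "bij_betw g (verts ?G) (verts ?H)"
    using g by (auto simp: bij_betw_def)
  moreover have "{u, v} \<in> edges ?G \<longleftrightarrow> {g u, g v} \<in> edges ?H"
    if "u \<in> verts ?G" "v \<in> verts ?G" for u v
    using fe[of "tag_vertex 0 u" "tag_vertex 0 v"] that g by (simp add: V edge_tag_tag)
  moreover have "g (root_vertex ?G) = root_vertex ?H"
    using fe[of 0 "tag_vertex 0 (root_vertex ?G)"] f0 g[of "root_vertex ?G"] by (simp add: V edge_zero)
  ultimately have "rooted_iso g ?G ?H" by (simp add: rooted_iso_def)
  then show ?thesis
    using abs_rtree_eq_iff[of ?G ?H] by auto
qed

lemma graft_bullet_B_plus: "graft_bullet A (B_plus [T]) = A T"
proof -
  have "(THE T1. B_plus [T] = B_plus [T1]) = T"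
    using B_plus_single_inject by (intro the_equality) auto
  then show ?thesis by (auto simp: graft_bullet_def)
qed

lemma ex1_Omega: "\<exists>!W. is_Omega W"
proof -
  define X where "X = (\<lambda>W. tscale qq (suspension qq W))"
  define F where "F = (\<lambda>T W. (graft_bullet W T + (qq - 1) * bullet T - Crls_lower (X W) bullet T)
    / (qq ^ tsize T - 1))"
  have X: "X W T = qq ^ tsize T * W T" for W T
    by (cases "tsize T") (use tsize_pos[of T] in \<open>auto simp: X_def tscale_def suspension_def\<close>)
  have "is_Omega W \<longleftrightarrow> (\<forall>T. W T = F T W)" for W
  proof -
    have *: "a * s + l - s = r \<longleftrightarrow> s = (r - l) / (a - 1)" if "a - 1 \<noteq> 0" for a s l r :: ratq
      using that by (auto simp: eq_divide_eq algebra_simps)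
    have "is_Omega W \<longleftrightarrow> (\<forall>T. Crls (X W) bullet T - W T = graft_bullet W T + (qq - 1) * bullet T)"
      unfolding is_Omega_def fun_eq_iff X_def by (simp only: minus_apply plus_fun_def tscale_def)
    also have "\<dots> \<longleftrightarrow> (\<forall>T. W T = F T W)"
      unfolding Crls_split F_def X[of W] using *[OF qq_power_neq_1[OF tsize_pos]] by simp
    finally show ?thesis .
  qed
  moreover have "\<exists>!W. \<forall>T. W T = F T W"
  proof (rule ex1_wf_nat[where m = tsize])
    fix T and A B :: "ratq tree_series"
    assume AB: "\<And>T'. tsize T' < tsize T \<Longrightarrow> A T' = B T'"
    have "Crls_lower (X A) bullet T = Crls_lower (X B) bullet T"
      by (rule Crls_lower_cong) (simp add: X AB)
    moreover have "graft_bullet A T = graft_bullet B T"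
    proof (cases "\<exists>T1. T = B_plus [T1]")
      case True
      then show ?thesis using AB by (auto simp: graft_bullet_B_plus tsize_B_plus_single)
    qed (simp add: graft_bullet_def)
    ultimately show "F T A = F T B" by (simp add: F_def)
  qed
  ultimately show ?thesis by simp
qed

lemma Psi_linear: "Psi (p + r) = Psi p + Psi r" "Psi (smult c p) = c * Psi p"
proof -
  have Psi: "Psi p = (\<Sum>n\<le>N. coeff p n * bernoulli_carlitz n)" if "degree p \<le> N" for p N
    unfolding Psi_def using that by (intro sum.mono_neutral_left) (auto simp: coeff_eq_0)
  let ?N = "max (degree p) (degree r)"
  show "Psi (p + r) = Psi p + Psi r"
    using Psi[of "p + r" ?N] Psi[of p ?N] Psi[of r ?N] degree_add_le_max[of p r]
    by (simp add: distrib_right sum.distrib)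
  show "Psi (smult c p) = c * Psi p"
    using Psi[of "smult c p" "degree p"] Psi[of p "degree p"] degree_smult_le[of c p]
    by (simp add: sum_distrib_left mult.assoc)
qed

lemma Psi_power: "Psi ([:0, 1:] ^ n) = bernoulli_carlitz n"
proof -
  have "[:0, 1:] ^ n = (monom 1 n :: ratq poly)"
    by (simp add: monom_altdef)
  then show ?thesis
    by (simp add: Psi_def degree_monom_eq) (simp add: if_distrib[of "\<lambda>c. c * _"] cong: if_cong)
qed

end

(* Put n = #T, Y_T = q^n S_T, s(x) = 1 + q x, and let f be Crls(S, -bullet) - bullet.
   Every rooted subtree of T meets each branch at the root in a rooted subtree or not at all, whence
     Crls(Crls(bullet, A), B) = Crls(bullet, Crls(A, B) + B),
   where the coefficient of B_+(T_1, ..., T_k) in Crls(bullet, A) is the product of the A_{T_i}.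
   The equation of S reads f = Y - q (1 + (q-1) x) Crls(bullet, Y). By induction on trees it implies
   f_T(1 + q x) = Y_T and f_T(0) = 0.
   The recursion of the Bernoulli-Carlitz numbers says q Psi(p o s) - Psi(p) = (q-1) p(0) + p'(0), and
   it follows that Psi(g) = p'(0) whenever p o s - p = (1 + (q-1) x) g.
   Apply the first identity to the product p of the f_{T_i}, and the second one to f_{T_1} to identify
   p'(0) when k = 1 (p'(0) = 0 when k is not 1): the series with coefficients Psi(prod S_{T_i})
   satisfies the equation of Omega transformed by q -> 1/q and Sigma_{-1/q}, whose solution is unique. *)

theory Submission
  imports Defs
begin

section \<open>Acyclic graphs and connected components\<close>

text \<open>A tree is a class of graphs, and \<open>Crls\<close> works on a chosen representative,
  so no branch can be computed before \<open>Crls\<close> is known to be invariant under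
  isomorphism. The distances in \<open>closest\<close> are avoided there: in an acyclic graph one
  edge joins a component to the subtree below it. The factor 1 + (q-1) x is s(x) - x. The equation
  of S does not mention s; what the induction really proves is the companion equation S o s - S = q
  (s - x) Crls(bullet, S o s). \<open>Crls\<close> is linear only in its first argument. Composition
  with s, evaluation at 0, Psi and q -> 1/q all pass through that argument, since the second one,
  bullet or -bullet, has integer coefficients. The inductions about S and about uniqueness end
  alike: q^n - 1, with n > 0, times the unknown is zero.\<close>

lemma is_cycleI:
  assumes "3 \<le> length vs" "distinct vs" "successively (\<lambda>a b. {a, b} \<in> E) vs" "{last vs, hd vs} \<in> E"
  shows "is_cycle E vs"
proof -
  have "{vs ! i, vs ! (Suc i mod length vs)} \<in> E" if i: "i < length vs" for i
  proof (cases "Suc i < length vs")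
    case True
    then show ?thesis using assms(3) by (simp add: successively_conv_nth)
  next
    case False
    then have "i = length vs - 1" "Suc i = length vs" using i by auto
    moreover have "vs \<noteq> []" using i by auto
    ultimately show ?thesis using assms(4) by (simp add: last_conv_nth hd_conv_nth)
  qed
  then show ?thesis using assms by (auto simp: is_cycle_def)
qed

text \<open>A walk that returns to an earlier vertex is cut there, so the list of its vertices stays
  distinct.\<close>

lemma rtrancl_adj_distinct_walk:
  assumes "(u, v) \<in> (adj E S)\<^sup>*" "u \<in> S"
  shows "\<exists>xs. xs \<noteq> [] \<and> hd xs = u \<and> last xs = v \<and> distinct xs \<and> set xs \<subseteq> S \<and>
    successively (\<lambda>a b. {a, b} \<in> E) xs"
  using assms(1)
proof (induction rule: rtrancl_induct)
  case base
  show ?case using assms(2) by (intro exI[of _ "[u]"]) auto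
next
  case (step y z)
  then obtain xs where xs: "xs \<noteq> []" "hd xs = u" "last xs = y" "distinct xs" "set xs \<subseteq> S"
    "successively (\<lambda>a b. {a, b} \<in> E) xs" by blast
  have yz: "z \<in> S" "{y, z} \<in> E" using step(2) by (auto simp: adj_def)
  show ?case
  proof (cases "z \<in> set xs")
    case True
    then obtain as bs where "xs = as @ z # bs" by (meson split_list)
    then show ?thesis
      using xs by (intro exI[of _ "as @ [z]"]) (auto simp: successively_append_iff hd_append)
  next
    case False
    then show ?thesis
      using xs yz by (intro exI[of _ "xs @ [z]"]) (auto simp: successively_append_iff)
  qed
qed

text \<open>Joined by simple paths inside \<open>C\<close> and \<open>D\<close>, two different edges
  between these sets would close a cycle.\<close>

lemma acyclic_unique_edge:
  assumes acyc: "\<nexists>vs. is_cycle E vs" and C: "connected_in E C" and D: "connected_in E D"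
    and disj: "C \<inter> D = {}" and "u \<in> C" "u' \<in> C" "w \<in> D" "w' \<in> D"
    and e: "{u, w} \<in> E" and e': "{u', w'} \<in> E"
  shows "u = u' \<and> w = w'"
proof (rule ccontr)
  assume neq: "\<not> (u = u' \<and> w = w')"
  obtain xs where xs: "xs \<noteq> []" "hd xs = u'" "last xs = u" "distinct xs" "set xs \<subseteq> C"
    "successively (\<lambda>a b. {a, b} \<in> E) xs"
    using rtrancl_adj_distinct_walk[of u' u E C] assms by (auto simp: connected_in_def)
  obtain ys where ys: "ys \<noteq> []" "hd ys = w" "last ys = w'" "distinct ys" "set ys \<subseteq> D"
    "successively (\<lambda>a b. {a, b} \<in> E) ys"
    using rtrancl_adj_distinct_walk[of w w' E D] assms by (auto simp: connected_in_def)
  \<comment> \<open>A cycle needs three vertices. Two paths of one vertex each would make the two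
    edges equal.\<close>
  have "length xs + length ys \<noteq> 2"
  proof
    assume "length xs + length ys = 2"
    moreover have "length xs \<noteq> 0" "length ys \<noteq> 0" using xs(1) ys(1) by auto
    ultimately have "length xs = 1" "length ys = 1" by linarith+
    then show False using neq xs(2,3) ys(2,3) by (auto simp: length_Suc_conv)
  qed
  moreover have "length xs \<noteq> 0" "length ys \<noteq> 0" using xs(1) ys(1) by auto
  ultimately have "3 \<le> length (xs @ ys)" unfolding length_append by linarith
  moreover have "distinct (xs @ ys)" using xs ys disj by auto
  moreover have "{last (xs @ ys), hd (xs @ ys)} \<in> E" using xs ys e' by (simp add: insert_commute)
  moreover have "successively (\<lambda>a b. {a, b} \<in> E) (xs @ ys)"
    using xs ys e by (auto simp: successively_append_iff)
  ultimately have "is_cycle E (xs @ ys)" by (intro is_cycleI)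
  then show False using acyc by blast
qed

lemma components_in_Union: "\<Union>(components_in E S) = S"
  by (auto simp: components_in_def)

lemma adj_mono: "S \<subseteq> T \<Longrightarrow> adj E S \<subseteq> adj E T"
  by (auto simp: adj_def)

lemma rtrancl_adj_in: "(u, v) \<in> (adj E S)\<^sup>* \<Longrightarrow> u \<in> S \<Longrightarrow> v \<in> S"
  by (induction rule: rtrancl_induct) (auto simp: adj_def)

lemma rtrancl_adj_sym: "(u, v) \<in> (adj E S)\<^sup>* \<Longrightarrow> (v, u) \<in> (adj E S)\<^sup>*"
  by (meson symD sym_rtrancl sym_adj)

lemma components_inD:
  assumes "C \<in> components_in E S" "u \<in> C"
  shows "C = {v. (u, v) \<in> (adj E S)\<^sup>*}"
proof -
  obtain a where a: "a \<in> S" "C = {v \<in> S. (a, v) \<in> (adj E S)\<^sup>*}"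
    using assms(1) by (auto simp: components_in_def)
  then have au: "(a, u) \<in> (adj E S)\<^sup>*" "(u, a) \<in> (adj E S)\<^sup>*"
    using assms(2) rtrancl_adj_sym by auto
  then show ?thesis
    using a rtrancl_adj_in[of a _ E S] by (auto intro: rtrancl_trans)
qed

lemma components_in_disjoint:
  "C \<in> components_in E S \<Longrightarrow> D \<in> components_in E S \<Longrightarrow> C \<inter> D \<noteq> {} \<Longrightarrow> C = D"
  using components_inD by (metis disjoint_iff)

lemma components_in_edge:
  assumes "C \<in> components_in E S" "u \<in> C" "v \<in> S" "{u, v} \<in> E"
  shows "v \<in> C"
proof -
  have "u \<in> S" using assms components_inE(1) by blast
  then have "(u, v) \<in> adj E S" using assms by (auto simp: adj_def)
  then show ?thesis using components_inD[OF assms(1,2)] by auto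
qed

lemma components_in_nonempty: "C \<in> components_in E S \<Longrightarrow> C \<noteq> {}"
  using components_inE(2) by (auto simp: connected_in_def)

lemma components_in_connected:
  assumes "connected_in E S"
  shows "components_in E S = {S}"
  using assms by (auto simp: components_in_def connected_in_def image_iff)

lemma finite_components_in [simp]: "finite S \<Longrightarrow> finite (components_in E S)"
  by (simp add: components_in_def)

lemma components_inI:
  assumes "connected_in E C" "C \<subseteq> S" and edge: "\<And>u v. u \<in> C \<Longrightarrow> v \<in> S \<Longrightarrow> {u, v} \<in> E \<Longrightarrow> v \<in> C"
  shows "C \<in> components_in E S"
proof -
  obtain a where a: "a \<in> C" using assms by (auto simp: connected_in_def)
  have "v \<in> C" if "(a, v) \<in> (adj E S)\<^sup>*" for v
    using that by (induction rule: rtrancl_induct) (use a edge in \<open>auto simp: adj_def\<close>)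
  moreover have "(a, v) \<in> (adj E S)\<^sup>*" if "v \<in> C" for v
    using assms(1) a that rtrancl_mono[OF adj_mono[OF assms(2), of E]] by (auto simp: connected_in_def)
  ultimately have "C = {v \<in> S. (a, v) \<in> (adj E S)\<^sup>*}" using assms(2) by auto
  then show ?thesis using a assms(2) by (auto simp: components_in_def)
qed

lemma components_in_UN:
  assumes edge: "\<And>i j u v. i \<in> I \<Longrightarrow> j \<in> I \<Longrightarrow> u \<in> X i \<Longrightarrow> v \<in> X j \<Longrightarrow> {u, v} \<in> E \<Longrightarrow> i = j"
  shows "components_in E (\<Union>i\<in>I. X i) = (\<Union>i\<in>I. components_in E (X i))"
proof -
  have *: "(\<Union>i\<in>I. components_in E (X i)) \<subseteq> components_in E (\<Union>i\<in>I. X i)"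
  proof
    fix C assume "C \<in> (\<Union>i\<in>I. components_in E (X i))"
    then obtain i where i: "i \<in> I" "C \<in> components_in E (X i)" by auto
    note C = components_inE[OF i(2)]
    show "C \<in> components_in E (\<Union>i\<in>I. X i)"
    proof (rule components_inI[OF C(2)])
      show "C \<subseteq> (\<Union>i\<in>I. X i)" using C(1) i(1) by auto
      fix u v assume "u \<in> C" "v \<in> (\<Union>i\<in>I. X i)" and e: "{u, v} \<in> E"
      then obtain j where "j \<in> I" "v \<in> X j" "u \<in> X i" using C(1) by auto
      moreover have "i = j" using edge[OF i(1) calculation(1,3,2) e] .
      ultimately show "v \<in> C" using components_in_edge[OF i(2) \<open>u \<in> C\<close>] e by blast
    qed
  qed
  \<comment> \<open>The components of the parts cover the union and are components of it by
    \<open>*\<close>; components that meet coincide, so there are no others.\<close>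
  moreover have "C \<in> (\<Union>i\<in>I. components_in E (X i))" if C: "C \<in> components_in E (\<Union>i\<in>I. X i)" for C
  proof -
    obtain u where u: "u \<in> C" using components_in_nonempty[OF C] by auto
    then obtain i where i: "i \<in> I" "u \<in> X i" using components_inE(1)[OF C] by auto
    then obtain C' where "C' \<in> components_in E (X i)" "u \<in> C'"
      using components_in_Union[of E "X i"] by auto
    moreover have "C' = C"
      using components_in_disjoint[of C' E "\<Union>i\<in>I. X i" C] * i calculation u C by blast
    ultimately show ?thesis using i by auto
  qed
  ultimately show ?thesis by blast
qed

lemma connected_in_exit_edge:
  assumes "(u, v) \<in> (adj E V)\<^sup>*" "u \<in> S" "v \<notin> S"
  shows "\<exists>a\<in>S. \<exists>b\<in>V - S. {a, b} \<in> E"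
  using assms by (induction rule: rtrancl_induct) (auto simp: adj_def)

lemma rooted_treeD:
  assumes "rooted_tree G"
  shows "finite (verts G)" "root_vertex G \<in> verts G" "connected_in (edges G) (verts G)"
    "\<nexists>vs. is_cycle (edges G) vs" "{u, v} \<in> edges G \<Longrightarrow> u \<noteq> v"
proof -
  show "{u, v} \<in> edges G \<Longrightarrow> u \<noteq> v"
    using assms unfolding rooted_tree_def by (metis doubleton_eq_iff)
qed (use assms in \<open>auto simp: rooted_tree_def\<close>)

text \<open>A path in \<open>G\<close> from \<open>C\<close> to \<open>S\<close> has to leave
  \<open>C\<close>. As \<open>C\<close> contains all its neighbours outside \<open>S\<close>, the
  edge by which it leaves ends in \<open>S\<close>.\<close>

lemma component_attached:
  assumes G: "rooted_tree G" and S: "S \<subseteq> verts G" "S \<noteq> {}"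
    and C: "C \<in> components_in (edges G) (verts G - S)"
  shows "\<exists>u\<in>S. \<exists>v\<in>C. {u, v} \<in> edges G"
proof -
  note C' = components_inE[OF C]
  obtain c s where c: "c \<in> C" and s: "s \<in> S" using components_in_nonempty[OF C] S by auto
  have "(c, s) \<in> (adj (edges G) (verts G))\<^sup>*"
    using rooted_treeD(3)[OF G] c s C' S by (auto simp: connected_in_def)
  from connected_in_exit_edge[OF this c] obtain a b
    where ab: "a \<in> C" "b \<in> verts G - C" "{a, b} \<in> edges G" using s C' by blast
  then have "b \<in> S" using components_in_edge[OF C ab(1) _ ab(3)] by blast
  then show ?thesis using ab by (metis insert_commute)
qed

text \<open>Only one edge joins \<open>S\<close> to \<open>C\<close>, so every walk from the root
  into \<open>C\<close> passes through its end \<open>v\<close>. This replaces the minimal distance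
  by a local condition that survives isomorphisms and passage to subgraphs.\<close>

lemma closest_eq:
  assumes G: "rooted_tree G" and S: "S \<subseteq> verts G" "root_vertex G \<in> S" "connected_in (edges G) S"
    and C: "C \<in> components_in (edges G) (verts G - S)"
    and uv: "u \<in> S" "v \<in> C" "{u, v} \<in> edges G"
  shows "closest G C = v"
proof -
  let ?A = "adj (edges G) (verts G)"
  define r where "r = root_vertex G"
  note C' = components_inE[OF C]
  \<comment> \<open>A walk of length \<open>n\<close> into \<open>C\<close> yields one to
    \<open>v\<close> that is no longer, and strictly shorter unless \<open>w = v\<close>. Strictness
    makes the minimiser unique.\<close>
  have enter: "\<exists>m\<le>n. (r, v) \<in> ?A ^^ m \<and> (m = n \<longrightarrow> w = v)" if "(r, w) \<in> ?A ^^ n" "w \<in> C" for n w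
    using that
  proof (induction n arbitrary: w)
    case 0
    then show ?case using S C' by (auto simp: r_def)
  next
    case (Suc n)
    then obtain y where y: "(r, y) \<in> ?A ^^ n" "(y, w) \<in> ?A" by auto
    have yw: "y \<in> verts G" "{y, w} \<in> edges G" using y(2) by (auto simp: adj_def)
    show ?case
    proof (cases "y \<in> C")
      case True
      then obtain m where "m \<le> n" "(r, v) \<in> ?A ^^ m" using Suc.IH[OF y(1)] by blast
      then show ?thesis by (metis le_SucI not_less_eq_eq)
    next
      case False
      then have "y \<in> S"
        using components_in_edge[OF C Suc.prems(2)] yw by (metis DiffI insert_commute)
      then have "w = v"
        using acyclic_unique_edge[OF rooted_treeD(4)[OF G] S(3) C'(2), of y u w v] C' Suc.prems yw uv
        by blast
      then show ?thesis using Suc.prems(1) by blast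
    qed
  qed
  have "graph_dist G r v < graph_dist G r w" if w: "w \<in> C" "w \<noteq> v" for w
  proof -
    have "(r, w) \<in> ?A\<^sup>*"
      using rooted_treeD(2,3)[OF G] w C' by (auto simp: connected_in_def r_def)
    then have "(r, w) \<in> ?A ^^ graph_dist G r w"
      unfolding graph_dist_def by (metis LeastI rtrancl_imp_relpow)
    from enter[OF this w(1)] obtain m where "m < graph_dist G r w" "(r, v) \<in> ?A ^^ m"
      using w by (metis le_neq_implies_less)
    then show ?thesis
      unfolding graph_dist_def by (meson Least_le le_less_trans)
  qed
  moreover have "closest G C \<in> C" "graph_dist G r (closest G C) \<le> graph_dist G r v"
    using arg_min_nat_lemma[of "\<lambda>v. v \<in> C" v "graph_dist G r"] uv(2)
    by (auto simp: closest_def r_def)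
  ultimately show ?thesis by (meson not_le)
qed

section \<open>Invariance of \<open>Crls\<close> under isomorphism\<close>

lemma rooted_isoD:
  assumes "rooted_iso f G H"
  shows "inj_on f (verts G)" "f ` verts G = verts H" "f (root_vertex G) = root_vertex H"
    "u \<in> verts G \<Longrightarrow> v \<in> verts G \<Longrightarrow> {f u, f v} \<in> edges H \<longleftrightarrow> {u, v} \<in> edges G"
  using assms by (auto simp: rooted_iso_def bij_betw_def)

lemma rooted_iso_rtrancl:
  assumes f: "rooted_iso f G H" and X: "X \<subseteq> verts G"
    and "(u, v) \<in> (adj (edges G) X)\<^sup>*"
  shows "(f u, f v) \<in> (adj (edges H) (f ` X))\<^sup>*"
  using assms(3)
proof (induction rule: rtrancl_induct)
  case (step y z)
  then have "(f y, f z) \<in> adj (edges H) (f ` X)"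
    using X rooted_isoD(4)[OF f, of y z] by (auto simp: adj_def)
  with step.IH show ?case by (rule rtrancl_into_rtrancl)
qed simp

lemma rooted_iso_connected:
  assumes "rooted_iso f G H" "X \<subseteq> verts G" "connected_in (edges G) X"
  shows "connected_in (edges H) (f ` X)"
  using assms(3) rooted_iso_rtrancl[OF assms(1,2)] by (auto simp: connected_in_def)

lemma rooted_iso_component:
  assumes f: "rooted_iso f G H" and X: "X \<subseteq> verts G" and C: "C \<in> components_in (edges G) X"
  shows "f ` C \<in> components_in (edges H) (f ` X)"
proof (rule components_inI)
  note C' = components_inE[OF C]
  show "connected_in (edges H) (f ` C)"
    using rooted_iso_connected[OF f _ C'(2)] C'(1) X by blast
  show "f ` C \<subseteq> f ` X" using C'(1) by blast
  fix u v assume "u \<in> f ` C" "v \<in> f ` X" and e: "{u, v} \<in> edges H"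
  then obtain a b where ab: "a \<in> C" "b \<in> X" "u = f a" "v = f b" by auto
  then have "{a, b} \<in> edges G" using rooted_isoD(4)[OF f, of a b] e X C'(1) by auto
  then show "v \<in> f ` C" using components_in_edge[OF C ab(1,2)] ab by blast
qed

lemma abs_induced_iso:
  assumes G: "rooted_tree G" and H: "rooted_tree H" and f: "rooted_iso f G H"
    and X: "X \<subseteq> verts G" "connected_in (edges G) X" and x: "x \<in> X"
  shows "abs_rtree (induced G X x) = abs_rtree (induced H (f ` X) (f x))"
proof -
  have "rooted_tree (induced G X x)"
    by (rule rooted_tree_induced[OF G X(1) x X(2)])
  moreover have "rooted_tree (induced H (f ` X) (f x))"
    using X rooted_isoD(2)[OF f] x by (intro rooted_tree_induced[OF H] rooted_iso_connected[OF f]) auto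
  moreover have "rooted_iso f (induced G X x) (induced H (f ` X) (f x))"
    using inj_on_subset[OF rooted_isoD(1)[OF f] X(1)] X(1) subsetD[OF X(1)]
    by (simp add: rooted_iso_def induced_def bij_betw_def rooted_isoD(4)[OF f])
  ultimately show ?thesis by (auto simp: abs_rtree_eq_iff)
qed

section \<open>Evaluation of \<open>Crls\<close> on an arbitrary representative\<close>

definition root_subtrees :: "rgraph \<Rightarrow> nat set set" where
  "root_subtrees G = {S. S \<subseteq> verts G \<and> root_vertex G \<in> S \<and> connected_in (edges G) S}"

definition branch :: "rgraph \<Rightarrow> nat set \<Rightarrow> rtree" where
  "branch G C = abs_rtree (induced G C (closest G C))"

definition Crls_graph :: "'a::comm_ring_1 tree_series \<Rightarrow> 'a tree_series \<Rightarrow> rgraph \<Rightarrow> 'a" where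
  "Crls_graph A B G = (\<Sum>S\<in>root_subtrees G. A (abs_rtree (induced G S (root_vertex G))) *
     (\<Prod>C\<in>components_in (edges G) (verts G - S). B (branch G C)))"

lemma Crls_rep: "Crls A B T = Crls_graph A B (rep_rtree T)"
  by (simp add: Crls_def Crls_graph_def root_subtrees_def branch_def Let_def)

lemma root_subtreesD:
  assumes "S \<in> root_subtrees G"
  shows "S \<subseteq> verts G" "root_vertex G \<in> S" "connected_in (edges G) S"
  using assms by (auto simp: root_subtrees_def)

lemma closest_in_component: "C \<in> components_in E S \<Longrightarrow> closest G C \<in> C"
  using components_in_nonempty by (intro closest_in)

text \<open>The isomorphism carries the edge attaching \<open>C\<close> to \<open>S\<close> to an
  edge attaching the image of \<open>C\<close>, and \<open>closest_eq\<close> reads off both closest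
  vertices without comparing distances.\<close>

lemma rooted_iso_branch:
  assumes G: "rooted_tree G" and H: "rooted_tree H" and f: "rooted_iso f G H"
    and S: "S \<in> root_subtrees G" and C: "C \<in> components_in (edges G) (verts G - S)"
  shows "branch H (f ` C) = branch G C"
proof -
  note S' = root_subtreesD[OF S] and C' = components_inE[OF C]
  have CV: "C \<subseteq> verts G" using C' by blast
  have "S \<noteq> {}" using S' by auto
  obtain u v where uv: "u \<in> S" "v \<in> C" "{u, v} \<in> edges G"
    using component_attached[OF G S'(1) \<open>S \<noteq> {}\<close> C] by blast
  have 1: "closest G C = v" by (rule closest_eq[OF G S' C uv])
  have "verts H - f ` S = f ` (verts G - S)"
    using rooted_isoD(2)[OF f] inj_on_image_set_diff[OF rooted_isoD(1)[OF f], of "verts G" S] S' by auto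
  then have "f ` C \<in> components_in (edges H) (verts H - f ` S)"
    using rooted_iso_component[OF f _ C] by auto
  moreover have "f ` S \<subseteq> verts H" "root_vertex H \<in> f ` S"
    using rooted_isoD(2)[OF f] S' by (auto simp flip: rooted_isoD(3)[OF f])
  moreover have "{f u, f v} \<in> edges H" using rooted_isoD(4)[OF f, of u v] uv S' CV by blast
  ultimately have "closest H (f ` C) = f v"
    using uv by (intro closest_eq[OF H _ _ rooted_iso_connected[OF f S'(1,3)], where u = "f u"]) auto
  then show ?thesis
    using abs_induced_iso[OF G H f CV C'(2) uv(2)] 1 by (simp add: branch_def)
qed

lemma rooted_iso_image_inv:
  assumes "rooted_iso f G H"
  shows "X \<subseteq> verts G \<Longrightarrow> inv_into (verts G) f ` f ` X = X"
    and "Y \<subseteq> verts H \<Longrightarrow> f ` inv_into (verts G) f ` Y = Y"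
  using rooted_isoD(1,2)[OF assms] by (auto simp: inv_into_image_cancel image_inv_into_cancel)

lemma rooted_iso_root_subtrees:
  assumes f: "rooted_iso f G H" and S: "S \<in> root_subtrees G"
  shows "f ` S \<in> root_subtrees H"
  using root_subtreesD[OF S] rooted_isoD(2)[OF f] rooted_iso_connected[OF f]
  by (auto simp: root_subtrees_def simp flip: rooted_isoD(3)[OF f])

lemma Crls_graph_iso:
  assumes G: "rooted_tree G" and H: "rooted_tree H" and f: "rooted_iso f G H"
  shows "Crls_graph A B G = Crls_graph A B H"
proof -
  let ?g = "inv_into (verts G) f"
  have g: "rooted_iso ?g H G" using rooted_iso_inv[OF f] rooted_treeD(2)[OF G] .
  note inv = rooted_iso_image_inv[OF f]
  show ?thesis
    unfolding Crls_graph_def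
  proof (rule sum.reindex_bij_witness[where i = "image ?g" and j = "image f"])
    fix S assume S: "S \<in> root_subtrees G"
    note S' = root_subtreesD[OF S]
    show "?g ` f ` S = S" using inv(1) S' by blast
    show "f ` S \<in> root_subtrees H" using rooted_iso_root_subtrees[OF f S] .
    have VH: "f ` (verts G - S) = verts H - f ` S"
      using rooted_isoD(2)[OF f] inj_on_image_set_diff[OF rooted_isoD(1)[OF f], of "verts G" S] S' by auto
    have VG: "?g ` (verts H - f ` S) = verts G - S"
      using inv(1)[of "verts G - S"] VH by auto
    have "(\<Prod>C\<in>components_in (edges G) (verts G - S). B (branch G C)) =
      (\<Prod>C\<in>components_in (edges H) (verts H - f ` S). B (branch H C))"
    proof (rule prod.reindex_bij_witness[where i = "image ?g" and j = "image f"])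
      fix C assume C: "C \<in> components_in (edges G) (verts G - S)"
      then have "C \<subseteq> verts G" using components_inE by blast
      then show "?g ` f ` C = C" using inv(1) by blast
      show "f ` C \<in> components_in (edges H) (verts H - f ` S)"
        using rooted_iso_component[OF f _ C] VH by auto
      show "B (branch H (f ` C)) = B (branch G C)"
        using rooted_iso_branch[OF G H f S C] by simp
    next
      fix C assume C: "C \<in> components_in (edges H) (verts H - f ` S)"
      then have "C \<subseteq> verts H" using components_inE by blast
      then show "f ` ?g ` C = C" using inv(2) by blast
      show "?g ` C \<in> components_in (edges G) (verts G - S)"
        using rooted_iso_component[OF g _ C] VG by auto
    qed
    moreover have "abs_rtree (induced G S (root_vertex G)) = abs_rtree (induced H (f ` S) (root_vertex H))"
      using abs_induced_iso[OF G H f S'(1,3,2)] rooted_isoD(3)[OF f] by simp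
    ultimately show "A (abs_rtree (induced H (f ` S) (root_vertex H))) *
      (\<Prod>C\<in>components_in (edges H) (verts H - f ` S). B (branch H C)) =
      A (abs_rtree (induced G S (root_vertex G))) *
      (\<Prod>C\<in>components_in (edges G) (verts G - S). B (branch G C))" by simp
  next
    fix S assume S: "S \<in> root_subtrees H"
    show "f ` ?g ` S = S" using inv(2) root_subtreesD[OF S] by blast
    show "?g ` S \<in> root_subtrees G" using rooted_iso_root_subtrees[OF g S] .
  qed
qed

text \<open>This allows \<open>Crls\<close> to be computed on whichever graph represents the tree,
  in particular on induced subgraphs and on \<open>grafted Ts\<close>.\<close>

lemma Crls_abs:
  assumes G: "rooted_tree G"
  shows "Crls A B (abs_rtree G) = Crls_graph A B G"
proof -
  obtain f where "rooted_iso f (rep_rtree (abs_rtree G)) G"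
    using rtree_rel_rep_abs[OF G] by (auto simp: rtree_rel_def)
  then show ?thesis unfolding Crls_rep by (rule Crls_graph_iso[OF rooted_tree_rep G])
qed

lemma finite_root_subtrees: "rooted_tree G \<Longrightarrow> finite (root_subtrees G)"
  by (rule finite_subset[of _ "Pow (verts G)"]) (auto simp: root_subtrees_def rooted_treeD)

lemma one_vertex_iff:
  assumes G: "rooted_tree G"
  shows "abs_rtree G = one_vertex \<longleftrightarrow> verts G = {root_vertex G}"
proof
  assume "abs_rtree G = one_vertex"
  then obtain f where "rooted_iso f (RGraph {0} {} 0) G"
    unfolding one_vertex_def using abs_rtree_eq_iff[OF rooted_tree_single G] by auto
  then show "verts G = {root_vertex G}"
    using rooted_isoD(2,3)[of f "RGraph {0} {} 0" G] by (metis image_empty image_insert rgraph.sel(1,3))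
next
  assume V: "verts G = {root_vertex G}"
  have "rooted_iso (\<lambda>_. 0) G (RGraph {0} {} 0)"
    using rooted_treeD(5)[OF G, of "root_vertex G" "root_vertex G"]
    unfolding rooted_iso_def bij_betw_def V by auto
  then show "abs_rtree G = one_vertex"
    unfolding one_vertex_def using abs_rtree_eq_iff[OF G rooted_tree_single] by blast
qed

lemma root_in_root_subtrees: "rooted_tree G \<Longrightarrow> {root_vertex G} \<in> root_subtrees G"
  using rooted_treeD(2) by (auto simp: root_subtrees_def connected_in_def)

lemma rooted_tree_root_subtree:
  "rooted_tree G \<Longrightarrow> S \<in> root_subtrees G \<Longrightarrow> rooted_tree (induced G S (root_vertex G))"
  using rooted_tree_induced root_subtreesD by metis

lemma induced_simps [simp]:
  "verts (induced G S r) = S" "root_vertex (induced G S r) = r"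
  by (simp_all add: induced_def)

text \<open>The factor \<open>bullet\<close> kills every root subtree except the root alone.\<close>

lemma Crls_bullet_abs:
  assumes G: "rooted_tree G"
  shows "Crls bullet X (abs_rtree G) =
    (\<Prod>C\<in>components_in (edges G) (verts G - {root_vertex G}). X (branch G C))"
proof -
  have "abs_rtree (induced G S (root_vertex G)) = one_vertex \<longleftrightarrow> S = {root_vertex G}"
    if "S \<in> root_subtrees G" for S
    using one_vertex_iff[OF rooted_tree_root_subtree[OF G that]] by simp
  then have "Crls bullet X (abs_rtree G) = (\<Sum>S\<in>root_subtrees G. if S = {root_vertex G} then
      \<Prod>C\<in>components_in (edges G) (verts G - S). X (branch G C) else 0)"
    unfolding Crls_abs[OF G] Crls_graph_def by (intro sum.cong) (auto simp: bullet_def)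
  then show ?thesis using G by (simp add: finite_root_subtrees root_in_root_subtrees)
qed

section \<open>The composition law of \<open>Crls\<close>\<close>

text \<open>Empty sets \<open>X i\<close> are allowed and contribute the factor 1: a root subtree
  may miss a branch or fill it.\<close>

lemma prod_components_in_UN:
  assumes "finite I" "\<And>i. i \<in> I \<Longrightarrow> finite (X i)"
    and disj: "\<And>i j. i \<in> I \<Longrightarrow> j \<in> I \<Longrightarrow> i \<noteq> j \<Longrightarrow> X i \<inter> X j = {}"
    and edge: "\<And>i j u v. i \<in> I \<Longrightarrow> j \<in> I \<Longrightarrow> u \<in> X i \<Longrightarrow> v \<in> X j \<Longrightarrow> {u, v} \<in> E \<Longrightarrow> i = j"
  shows "(\<Prod>C\<in>components_in E (\<Union>i\<in>I. X i). f C) = (\<Prod>i\<in>I. \<Prod>C\<in>components_in E (X i). f C)"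
proof -
  have "components_in E (X i) \<inter> components_in E (X j) = {}" if "i \<in> I" "j \<in> I" "i \<noteq> j" for i j
  proof (rule equals0I)
    fix C assume "C \<in> components_in E (X i) \<inter> components_in E (X j)"
    then show False
      using components_inE(1)[of C E "X i"] components_inE(1)[of C E "X j"]
        components_in_nonempty[of C E "X i"] disj[OF that] by blast
  qed
  moreover have "components_in E (\<Union>i\<in>I. X i) = (\<Union>i\<in>I. components_in E (X i))"
    by (rule components_in_UN) (rule edge)
  ultimately show ?thesis
    using assms(1,2) by (simp add: prod.UNION_disjoint)
qed

lemma adj_induced_subset: "X \<subseteq> S \<Longrightarrow> adj (edges (induced G S r)) X = adj (edges G) X"
  by (auto simp: adj_def induced_def)

lemma connected_in_induced:
  "X \<subseteq> S \<Longrightarrow> connected_in (edges (induced G S r)) X \<longleftrightarrow> connected_in (edges G) X"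
  by (simp add: connected_in_def adj_induced_subset)

lemma components_in_induced:
  "X \<subseteq> S \<Longrightarrow> components_in (edges (induced G S r)) X = components_in (edges G) X"
  by (simp add: components_in_def adj_induced_subset)

lemma induced_induced: "C \<subseteq> S \<Longrightarrow> induced (induced G S r) C c = induced G C c"
  by (auto simp: induced_def)

lemma connected_inI:
  assumes "r \<in> S" "\<And>v. v \<in> S \<Longrightarrow> (r, v) \<in> (adj E S)\<^sup>*"
  shows "connected_in E S"
proof -
  have "(u, v) \<in> (adj E S)\<^sup>*" if "u \<in> S" "v \<in> S" for u v
    using assms(2)[OF that(1)] assms(2)[OF that(2)] rtrancl_adj_sym rtrancl_trans by metis
  then show ?thesis using assms(1) by (auto simp: connected_in_def)
qed

section \<open>Root subtrees as independent choices in the branches\<close>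

definition root_components :: "rgraph \<Rightarrow> nat set set" where
  "root_components G = components_in (edges G) (verts G - {root_vertex G})"

context
  fixes G :: rgraph
  assumes G: "rooted_tree G"
begin

lemma root_component_subset: "D \<in> root_components G \<Longrightarrow> D \<subseteq> verts G - {root_vertex G}"
  unfolding root_components_def by (rule components_inE)

lemma root_component_finite: "D \<in> root_components G \<Longrightarrow> finite D"
  using root_component_subset rooted_treeD(1)[OF G] by (meson finite_Diff finite_subset)

lemma finite_root_components: "finite (root_components G)"
  using rooted_treeD(1)[OF G] by (simp add: root_components_def)

lemma root_component_connected: "D \<in> root_components G \<Longrightarrow> connected_in (edges G) D"
  unfolding root_components_def by (rule components_inE)

lemma root_component_disjoint:
  "C \<in> root_components G \<Longrightarrow> D \<in> root_components G \<Longrightarrow> C \<noteq> D \<Longrightarrow> C \<inter> D = {}"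
  unfolding root_components_def by (metis components_in_disjoint)

lemma Union_root_components: "\<Union>(root_components G) = verts G - {root_vertex G}"
  by (simp add: root_components_def components_in_Union)

lemma root_component_edge:
  assumes "C \<in> root_components G" "u \<in> C" "v \<in> verts G - {root_vertex G}" "{u, v} \<in> edges G"
  shows "v \<in> C"
  using components_in_edge[of C] assms unfolding root_components_def by blast

lemma root_component_edge_eq:
  assumes "C \<in> root_components G" "D \<in> root_components G" "u \<in> C" "v \<in> D" "{u, v} \<in> edges G"
  shows "C = D"
proof -
  have "v \<in> C" using root_component_edge[OF assms(1,3) _ assms(5)] root_component_subset[OF assms(2)] assms(4) by blast
  then show ?thesis using root_component_disjoint[OF assms(1,2)] assms(4) by blast
qed

lemma closest_root_component:
  assumes D: "D \<in> root_components G" and v: "v \<in> D" "{root_vertex G, v} \<in> edges G"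
  shows "closest G D = v"
  using closest_eq[OF G root_subtreesD[OF root_in_root_subtrees[OF G]] D[unfolded root_components_def] _ v]
  by blast

lemma root_edge_closest:
  assumes D: "D \<in> root_components G"
  shows "{root_vertex G, closest G D} \<in> edges G" "closest G D \<in> D"
proof -
  obtain v where "v \<in> D" "{root_vertex G, v} \<in> edges G"
    using component_attached[OF G root_subtreesD(1)[OF root_in_root_subtrees[OF G]]]
      D[unfolded root_components_def] by blast
  then show "{root_vertex G, closest G D} \<in> edges G" "closest G D \<in> D"
    using closest_root_component[OF D] by simp_all
qed

lemma rooted_tree_root_component:
  assumes "D \<in> root_components G"
  shows "rooted_tree (induced G D (closest G D))"
  using root_component_subset[OF assms] root_component_connected[OF assms] root_edge_closest(2)[OF assms]
  by (intro rooted_tree_induced[OF G]) auto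

text \<open>A path in \<open>S\<close> from the root can enter \<open>D\<close> only along the edge
  from the root to \<open>closest G D\<close>.\<close>

lemma root_subtree_Int_root_component:
  assumes S: "S \<in> root_subtrees G" and D: "D \<in> root_components G" and z: "z \<in> S \<inter> D"
  shows "closest G D \<in> S" "(closest G D, z) \<in> (adj (edges G) (S \<inter> D))\<^sup>*"
proof -
  note S' = root_subtreesD[OF S]
  have "(root_vertex G, z) \<in> (adj (edges G) S)\<^sup>*"
    using S' z by (auto simp: connected_in_def)
  \<comment> \<open>An implication, because the path may visit other branches before it enters
    \<open>D\<close>.\<close>
  then have "z \<in> D \<longrightarrow> closest G D \<in> S \<and> (closest G D, z) \<in> (adj (edges G) (S \<inter> D))\<^sup>*"
  proof (induction rule: rtrancl_induct)
    case base
    then show ?case using root_component_subset[OF D] by blast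
  next
    case (step y z)
    have yz: "y \<in> S" "z \<in> S" "{y, z} \<in> edges G" using step(2) by (auto simp: adj_def)
    show ?case
    proof (intro impI)
      assume z: "z \<in> D"
      show "closest G D \<in> S \<and> (closest G D, z) \<in> (adj (edges G) (S \<inter> D))\<^sup>*"
      proof (cases "y = root_vertex G")
        case True
        then have "closest G D = z" using closest_root_component[OF D z] yz by simp
        then show ?thesis using yz by simp
      next
        case False
        then have "y \<in> D"
          using root_component_edge[OF D z, of y] yz S' by (auto simp: insert_commute)
        moreover have "(y, z) \<in> adj (edges G) (S \<inter> D)" using yz calculation z by (auto simp: adj_def)
        ultimately show ?thesis using step.IH by (auto intro: rtrancl_into_rtrancl)
      qed
    qed
  qed
  then show "closest G D \<in> S" "(closest G D, z) \<in> (adj (edges G) (S \<inter> D))\<^sup>*" using z by auto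
qed

lemma root_subtrees_root_component:
  "D \<in> root_components G \<Longrightarrow> root_subtrees (induced G D (closest G D)) =
     {X. X \<subseteq> D \<and> closest G D \<in> X \<and> connected_in (edges G) X}"
  by (auto simp: root_subtrees_def connected_in_induced)

text \<open>Together with \<open>insert_root_subtrees\<close>, this makes a root subtree of
  \<open>G\<close> the same as an independent choice, in each branch, of nothing or of a root
  subtree of that branch.\<close>

lemma root_subtree_Int:
  assumes S: "S \<in> root_subtrees G" and D: "D \<in> root_components G"
  shows "S \<inter> D \<in> insert {} (root_subtrees (induced G D (closest G D)))"
proof (cases "S \<inter> D = {}")
  case False
  then have "closest G D \<in> S \<inter> D"
    using root_subtree_Int_root_component[OF S D] root_edge_closest(2)[OF D] by auto
  then show ?thesis
    unfolding root_subtrees_root_component[OF D]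
    using connected_inI[of "closest G D" "S \<inter> D"] root_subtree_Int_root_component(2)[OF S D] by auto
qed simp

lemma insert_root_subtrees:
  assumes X: "\<And>D. D \<in> root_components G \<Longrightarrow> X D \<in> insert {} (root_subtrees (induced G D (closest G D)))"
  shows "insert (root_vertex G) (\<Union>D\<in>root_components G. X D) \<in> root_subtrees G"
proof -
  let ?r = "root_vertex G" and ?S = "insert (root_vertex G) (\<Union>D\<in>root_components G. X D)"
  have sub: "X D \<subseteq> D" if "D \<in> root_components G" for D
    using X[OF that] root_subtrees_root_component[OF that] by auto
  have "(?r, z) \<in> (adj (edges G) ?S)\<^sup>*" if z: "z \<in> ?S" for z
  proof (cases "z = ?r")
    case False
    then obtain D where D: "D \<in> root_components G" "z \<in> X D" using z by auto
    then have XD: "closest G D \<in> X D" "connected_in (edges G) (X D)"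
      using X[OF D(1)] root_subtrees_root_component[OF D(1)] by auto
    have "(closest G D, z) \<in> (adj (edges G) (X D))\<^sup>*" using XD D by (auto simp: connected_in_def)
    moreover have "X D \<subseteq> ?S" using D by auto
    ultimately have "(closest G D, z) \<in> (adj (edges G) ?S)\<^sup>*"
      using rtrancl_mono[OF adj_mono] by blast
    moreover have "(?r, closest G D) \<in> adj (edges G) ?S"
      using XD D root_edge_closest(1)[OF D(1)] by (auto simp: adj_def)
    ultimately show ?thesis by (rule converse_rtrancl_into_rtrancl[rotated])
  qed simp
  then have "connected_in (edges G) ?S" by (intro connected_inI[of ?r]) auto
  moreover have "?S \<subseteq> verts G" using rooted_treeD(2)[OF G] sub root_component_subset by blast
  ultimately show ?thesis by (auto simp: root_subtrees_def)
qed

text \<open>The two values of \<open>closest\<close> refer to graphs with different roots. Both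
  equal the end in \<open>C\<close> of the edge that joins \<open>X\<close> to
  \<open>C\<close>.\<close>

lemma branch_induced:
  assumes D: "D \<in> root_components G" and X: "X \<in> root_subtrees (induced G D (closest G D))"
    and C: "C \<in> components_in (edges G) (D - X)"
  shows "branch (induced G D (closest G D)) C = branch G C"
proof -
  let ?H = "induced G D (closest G D)" and ?S = "insert (root_vertex G) X"
  have H: "rooted_tree ?H" by (rule rooted_tree_root_component[OF D])
  note X' = root_subtreesD[OF X, simplified]
  note DV = root_component_subset[OF D]
  note C' = components_inE[OF C]
  have CH: "C \<in> components_in (edges ?H) (verts ?H - X)"
    using C by (simp add: components_in_induced)
  obtain u v where uv: "u \<in> X" "v \<in> C" "{u, v} \<in> edges ?H"
    using component_attached[OF H _ _ CH] X' by auto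
  have "closest ?H C = v"
    by (rule closest_eq[OF H root_subtreesD[OF X] CH uv])
  moreover have "closest G C = v"
  proof (rule closest_eq[OF G])
    \<comment> \<open>\<open>Y\<close> chooses \<open>X\<close> in \<open>D\<close> and nothing in
      the other branches, so \<open>X\<close> with the root added is a root subtree of
      \<open>G\<close>.\<close>
    define Y where "Y = (\<lambda>D'. if D' = D then X else {})"
    have "?S = insert (root_vertex G) (\<Union>D\<in>root_components G. Y D)" using D by (auto simp: Y_def)
    moreover have "\<dots> \<in> root_subtrees G" using X by (intro insert_root_subtrees) (simp add: Y_def)
    ultimately have S: "?S \<in> root_subtrees G" by simp
    then show "?S \<subseteq> verts G" "root_vertex G \<in> ?S" "connected_in (edges G) ?S"
      using root_subtreesD by blast+
    show "C \<in> components_in (edges G) (verts G - ?S)"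
    proof (rule components_inI[OF C'(2)])
      show "C \<subseteq> verts G - ?S" using C'(1) DV by blast
      fix a b assume ab: "a \<in> C" "b \<in> verts G - ?S" "{a, b} \<in> edges G"
      then have "b \<in> D - X" using root_component_edge[OF D, of a b] C'(1) by blast
      then show "b \<in> C" using components_in_edge[OF C ab(1)] ab(3) by blast
    qed
    show "u \<in> ?S" "v \<in> C" "{u, v} \<in> edges G" using uv by (auto simp: induced_def)
  qed
  moreover have "C \<subseteq> D" using C' by blast
  ultimately show ?thesis by (simp add: branch_def induced_induced)
qed

text \<open>Within \<open>S\<close>, the part in \<open>D\<close> hangs on the same edge at the root
  as \<open>D\<close> does in \<open>G\<close>.\<close>

lemma branch_root_subtree:
  assumes S: "S \<in> root_subtrees G" and D: "D \<in> root_components G" and SD: "S \<inter> D \<noteq> {}"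
  shows "branch (induced G S (root_vertex G)) (S \<inter> D) = abs_rtree (induced G (S \<inter> D) (closest G D))"
proof -
  let ?G = "induced G S (root_vertex G)"
  have G': "rooted_tree ?G" by (rule rooted_tree_root_subtree[OF G S])
  have d: "closest G D \<in> S \<inter> D"
    using SD root_subtree_Int_root_component(1)[OF S D] root_edge_closest(2)[OF D] by blast
  have conn: "connected_in (edges G) (S \<inter> D)"
    using root_subtree_Int[OF S D] SD root_subtrees_root_component[OF D] by auto
  have "S \<inter> D \<in> components_in (edges G) (S - {root_vertex G})"
  proof (rule components_inI[OF conn])
    show "S \<inter> D \<subseteq> S - {root_vertex G}" using root_component_subset[OF D] by blast
    fix u v assume "u \<in> S \<inter> D" "v \<in> S - {root_vertex G}" "{u, v} \<in> edges G"
    then show "v \<in> S \<inter> D" using root_component_edge[OF D, of u v] root_subtreesD(1)[OF S] by blast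
  qed
  then have "S \<inter> D \<in> components_in (edges ?G) (verts ?G - {root_vertex ?G})"
    by (simp add: components_in_induced)
  moreover have "{root_vertex ?G, closest G D} \<in> edges ?G"
    using d root_edge_closest(1)[OF D] root_subtreesD(2)[OF S] by (simp add: induced_def)
  ultimately have "closest ?G (S \<inter> D) = closest G D"
    by (intro closest_eq[OF G' root_subtreesD[OF root_in_root_subtrees[OF G']] _ _ d]) auto
  then show ?thesis by (simp add: branch_def induced_induced)
qed

text \<open>As the choices in the branches are independent, the sum of products factors into a
  product of sums. In one branch the nonempty choices give \<open>Crls A B\<close>, and the empty
  choice gives the extra \<open>B\<close>.\<close>

lemma Crls_Crls_bullet_graph:
  fixes A B :: "'a::comm_ring_1 tree_series"
  shows "Crls (Crls bullet A) B (abs_rtree G) = Crls bullet (Crls A B + B) (abs_rtree G)"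
proof -
  let ?D = "root_components G" and ?r = "root_vertex G"
  let ?H = "\<lambda>D. induced G D (closest G D)"
  \<comment> \<open>\<open>h D X\<close> is the contribution of the branch \<open>D\<close> when the
    subtree meets it in \<open>X\<close>. If \<open>X\<close> is empty, \<open>D\<close> is left
    over as a single component.\<close>
  define h where "h = (\<lambda>D X. if X = {} then B (branch G D) else
    A (abs_rtree (induced G X (closest G D))) * (\<Prod>C\<in>components_in (edges G) (D - X). B (branch G C)))"
  have fin: "finite D" if "D \<in> ?D" for D by (rule root_component_finite[OF that])
  have summand: "Crls bullet A (abs_rtree (induced G S ?r)) *
      (\<Prod>C\<in>components_in (edges G) (verts G - S). B (branch G C)) = (\<Prod>D\<in>?D. h D (S \<inter> D))"
    if S: "S \<in> root_subtrees G" for S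
  proof -
    let ?G = "induced G S ?r"
    note S' = root_subtreesD[OF S]
    have split: "(\<Prod>C\<in>components_in (edges G) (\<Union>D\<in>?D. X D). f C) =
        (\<Prod>D\<in>?D. \<Prod>C\<in>components_in (edges G) (X D). f C)" if X: "\<And>D. X D \<subseteq> D"
      for X and f :: "nat set \<Rightarrow> 'a"
    proof (rule prod_components_in_UN[OF finite_root_components])
      show "finite (X D)" if "D \<in> ?D" for D using finite_subset[OF X fin[OF that]] .
      show "X C \<inter> X D = {}" if "C \<in> ?D" "D \<in> ?D" "C \<noteq> D" for C D
        using root_component_disjoint[OF that] X by blast
      show "C = D" if "C \<in> ?D" "D \<in> ?D" "u \<in> X C" "v \<in> X D" "{u, v} \<in> edges G" for C D u v
        using root_component_edge_eq[OF that(1,2) _ _ that(5)] X that(3,4) by blast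
    qed
    have "verts G - S = (\<Union>D\<in>?D. D - S)"
      using Union_root_components S' by blast
    then have "(\<Prod>C\<in>components_in (edges G) (verts G - S). B (branch G C)) =
      (\<Prod>D\<in>?D. \<Prod>C\<in>components_in (edges G) (D - S). B (branch G C))"
      using split[of "\<lambda>D. D - S"] by simp
    moreover have "Crls bullet A (abs_rtree ?G) =
        (\<Prod>D\<in>?D. \<Prod>C\<in>components_in (edges G) (S \<inter> D). A (branch ?G C))"
    proof -
      have "S - {?r} = (\<Union>D\<in>?D. S \<inter> D)" using Union_root_components S' by blast
      then have "components_in (edges ?G) (S - {?r}) = components_in (edges G) (\<Union>D\<in>?D. S \<inter> D)"
        by (simp add: components_in_induced)
      then show ?thesis
        unfolding Crls_bullet_abs[OF rooted_tree_root_subtree[OF G S]] induced_simps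
        using split[of "\<lambda>D. S \<inter> D"] by simp
    qed
    moreover have "(\<Prod>C\<in>components_in (edges G) (S \<inter> D). A (branch ?G C)) *
        (\<Prod>C\<in>components_in (edges G) (D - S). B (branch G C)) = h D (S \<inter> D)" if D: "D \<in> ?D" for D
    proof (cases "S \<inter> D = {}")
      case True
      then have "D - S = D" by blast
      then show ?thesis
        using True components_in_connected[OF root_component_connected[OF D]] by (simp add: h_def)
    next
      case False
      then have "connected_in (edges G) (S \<inter> D)"
        using root_subtree_Int[OF S D] root_subtrees_root_component[OF D] by auto
      moreover have "D - S = D - S \<inter> D" by blast
      ultimately show ?thesis
        using False branch_root_subtree[OF S D False] by (simp add: h_def components_in_connected)
    qed
    ultimately show ?thesis by (simp flip: prod.distrib)
  qed
  have "Crls (Crls bullet A) B (abs_rtree G) = (\<Sum>S\<in>root_subtrees G. \<Prod>D\<in>?D. h D (S \<inter> D))"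
    unfolding Crls_abs[OF G] Crls_graph_def using summand by (intro sum.cong) auto
  \<comment> \<open>Members of \<open>PiE\<close> are undefined outside the index set, hence the
    restricted lambda in the map from subtrees to families.\<close>
  also have "\<dots> = (\<Sum>X\<in>PiE ?D (\<lambda>D. insert {} (root_subtrees (?H D))). \<Prod>D\<in>?D. h D (X D))"
  proof (rule sum.reindex_bij_witness[where
      i = "\<lambda>X. insert ?r (\<Union>D\<in>?D. X D)" and j = "\<lambda>S. \<lambda>D\<in>?D. S \<inter> D"])
    fix S assume S: "S \<in> root_subtrees G"
    show "insert ?r (\<Union>D\<in>?D. (\<lambda>D\<in>?D. S \<inter> D) D) = S"
    proof -
      have "(\<Union>D\<in>?D. (\<lambda>D\<in>?D. S \<inter> D) D) = S \<inter> \<Union>?D" by auto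
      then show ?thesis using Union_root_components root_subtreesD[OF S] by auto
    qed
    show "(\<lambda>D\<in>?D. S \<inter> D) \<in> PiE ?D (\<lambda>D. insert {} (root_subtrees (?H D)))"
      by (rule restrict_PiE_iff[THEN iffD2]) (use root_subtree_Int[OF S] in blast)
    show "(\<Prod>D\<in>?D. h D ((\<lambda>D\<in>?D. S \<inter> D) D)) = (\<Prod>D\<in>?D. h D (S \<inter> D))" by simp
  next
    fix X assume X: "X \<in> PiE ?D (\<lambda>D. insert {} (root_subtrees (?H D)))"
    then have X': "X D \<in> insert {} (root_subtrees (?H D))" if "D \<in> ?D" for D
      by (rule PiE_mem[OF _ that])
    show "insert ?r (\<Union>D\<in>?D. X D) \<in> root_subtrees G"
      by (rule insert_root_subtrees) (rule X')
    have sub: "X D \<subseteq> D" if "D \<in> ?D" for D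
      using X'[OF that] root_subtrees_root_component[OF that] by auto
    have "insert ?r (\<Union>D\<in>?D. X D) \<inter> D = X D" if D: "D \<in> ?D" for D
    proof -
      have "X D' \<inter> D = {}" if "D' \<in> ?D" "D' \<noteq> D" for D'
        using sub[OF that(1)] root_component_disjoint[OF that(1) D that(2)] by blast
      then have "(\<Union>D\<in>?D. X D) \<inter> D = X D \<inter> D" using D by fast
      then show ?thesis using sub[OF D] root_component_subset[OF D] by blast
    qed
    then have "restrict (\<lambda>D. insert ?r (\<Union>D\<in>?D. X D) \<inter> D) ?D = restrict X ?D"
      by (rule restrict_ext)
    then show "(\<lambda>D\<in>?D. insert ?r (\<Union>D\<in>?D. X D) \<inter> D) = X"
      using PiE_restrict[OF X] by simp
  qed
  also have "\<dots> = (\<Prod>D\<in>?D. \<Sum>X\<in>insert {} (root_subtrees (?H D)). h D X)"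
    using finite_root_subtrees[OF rooted_tree_root_component]
    by (intro prod_sum_PiE[symmetric] finite_root_components) auto
  also have "\<dots> = (\<Prod>D\<in>?D. (Crls A B + B) (branch G D))"
  proof (rule prod.cong[OF refl])
    fix D assume D: "D \<in> ?D"
    have H: "rooted_tree (?H D)" by (rule rooted_tree_root_component[OF D])
    have "Crls A B (branch G D) = (\<Sum>X\<in>root_subtrees (?H D). h D X)"
      unfolding branch_def[of G D] Crls_abs[OF H] Crls_graph_def
    proof (rule sum.cong[OF refl])
      fix X assume X: "X \<in> root_subtrees (?H D)"
      note X' = root_subtreesD[OF X, simplified]
      have "X \<noteq> {}" using X' by auto
      then show "A (abs_rtree (induced (?H D) X (root_vertex (?H D)))) *
        (\<Prod>C\<in>components_in (edges (?H D)) (verts (?H D) - X). B (branch (?H D) C)) = h D X"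
        using X' branch_induced[OF D X] by (simp add: h_def induced_induced components_in_induced)
    qed
    moreover have "{} \<notin> root_subtrees (?H D)" by (auto simp: root_subtrees_def)
    ultimately show "(\<Sum>X\<in>insert {} (root_subtrees (?H D)). h D X) = (Crls A B + B) (branch G D)"
      using finite_root_subtrees[OF H] by (simp add: h_def)
  qed
  also have "\<dots> = Crls bullet (Crls A B + B) (abs_rtree G)"
    unfolding Crls_bullet_abs[OF G] root_components_def ..
  finally show ?thesis .
qed

end

lemma Crls_Crls_bullet: "Crls (Crls bullet A) B = Crls bullet (Crls A B + B)"
  using Crls_Crls_bullet_graph[OF rooted_tree_rep] by (auto simp: fun_eq_iff)

text \<open>Homogeneity: the sizes of a subtree and of the components of its complement add up to
  \<open>tsize T\<close>.\<close>

lemma Crls_power_tsize: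
  "Crls (\<lambda>T. a ^ tsize T * A T) (\<lambda>T. a ^ tsize T * B T) T = a ^ tsize T * Crls A B T"
proof -
  let ?G = "rep_rtree T"
  have G: "rooted_tree ?G" by simp
  have "a ^ tsize (abs_rtree (induced ?G S (root_vertex ?G))) *
      (\<Prod>C\<in>components_in (edges ?G) (verts ?G - S). a ^ tsize (branch ?G C)) = a ^ tsize T"
    if S: "S \<in> root_subtrees ?G" for S
  proof -
    let ?C = "components_in (edges ?G) (verts ?G - S)"
    note S' = root_subtreesD[OF S]
    have "tsize (branch ?G C) = card C" if C: "C \<in> ?C" for C
    proof -
      note C' = components_inE[OF C]
      have "rooted_tree (induced ?G C (closest ?G C))"
        using C' closest_in_component[OF C] by (intro rooted_tree_induced[OF G]) auto
      then show ?thesis by (simp add: branch_def tsize_abs)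
    qed
    then have "(\<Prod>C\<in>?C. a ^ tsize (branch ?G C)) = a ^ (\<Sum>C\<in>?C. card C)"
      by (simp add: power_sum)
    also have "(\<Sum>C\<in>?C. card C) = card (\<Union>?C)"
    proof (rule card_Union_disjoint[symmetric])
      show "pairwise disjnt ?C" unfolding pairwise_def disjnt_def using components_in_disjoint by metis
      show "finite C" if "C \<in> ?C" for C
        using components_inE(1)[OF that] by (rule finite_subset) simp
    qed
    also have "\<dots> = card (verts ?G - S)" by (simp add: components_in_Union)
    moreover have "card S + card (verts ?G - S) = tsize T"
      using S' by (simp add: tsize_def card_Diff_subset finite_subset card_mono)
    moreover have "tsize (abs_rtree (induced ?G S (root_vertex ?G))) = card S"
      by (simp add: tsize_abs rooted_tree_root_subtree[OF G S])
    ultimately show ?thesis by (simp flip: power_add)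
  qed
  then have "Crls_graph (\<lambda>T. a ^ tsize T * A T) (\<lambda>T. a ^ tsize T * B T) ?G = a ^ tsize T * Crls_graph A B ?G"
    unfolding Crls_graph_def sum_distrib_left
    by (intro sum.cong) (simp_all add: prod.distrib mult_ac flip: mult.assoc)
  then show ?thesis by (simp add: Crls_rep)
qed

section \<open>Branches at the root\<close>

lemma Crls_bullet_root_components:
  "rooted_tree G \<Longrightarrow> Crls bullet X (abs_rtree G) = (\<Prod>C\<in>root_components G. X (branch G C))"
  by (simp add: Crls_bullet_abs root_components_def)

lemma rooted_iso_tag:
  assumes "i < length Ts"
  shows "rooted_iso (tag_vertex i) (rep_rtree (Ts ! i)) (induced (grafted Ts)
    (tag_vertex i ` verts (rep_rtree (Ts ! i))) (tag_vertex i (root_vertex (rep_rtree (Ts ! i)))))"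
  using assms by (auto simp: rooted_iso_def bij_betw_def inj_on_def induced_def edge_tag_tag)

lemma root_vertex_grafted [simp]: "root_vertex (grafted Ts) = 0"
  by (simp add: grafted_def Let_def)

text \<open>The computation runs over positions in the list because equal trees may be repeated; the
  tags keep their copies apart as root components of \<open>grafted Ts\<close>.\<close>

lemma Crls_bullet_B_plus: "Crls bullet X (B_plus Ts) = (\<Prod>T\<leftarrow>Ts. X T)"
proof -
  let ?G = "grafted Ts" and ?n = "length Ts"
  define V where "V = (\<lambda>i. tag_vertex i ` verts (rep_rtree (Ts ! i)))"
  have G: "rooted_tree ?G" by (rule rooted_tree_grafted)
  have V: "verts ?G - {root_vertex ?G} = (\<Union>i<?n. V i)"
    unfolding set_eq_iff by (auto simp: verts_grafted V_def simp del: UN_simps)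
      (metis neq0_conv tag_vertex_simps(2))
  have edge: "i = j" if "u \<in> V i" "v \<in> V j" "{u, v} \<in> edges ?G" for i j u v
    using that by (auto simp: V_def edge_tag_tag)
  have conn: "connected_in (edges ?G) (V i)" if i: "i < ?n" for i
  proof -
    let ?H = "induced ?G (V i) (tag_vertex i (root_vertex (rep_rtree (Ts ! i))))"
    have "connected_in (edges ?H) (V i)"
      using rooted_iso_connected[OF rooted_iso_tag[OF i] subset_refl] rooted_treeD(3)[OF rooted_tree_rep]
      by (simp add: V_def)
    then show ?thesis by (simp add: connected_in_induced)
  qed
  have comp: "components_in (edges ?G) (V i) = {V i}" if "i < ?n" for i
    using components_in_connected[OF conn[OF that]] .
  have branch: "branch ?G (V i) = Ts ! i" if i: "i < ?n" for i
  proof -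
    let ?r = "root_vertex (rep_rtree (Ts ! i))"
    have "components_in (edges ?G) (\<Union>i<?n. V i) = (\<Union>i<?n. components_in (edges ?G) (V i))"
      using edge by (intro components_in_UN) blast
    then have D: "V i \<in> root_components ?G" unfolding root_components_def V using comp i by auto
    have "closest ?G (V i) = tag_vertex i ?r"
      using i by (intro closest_root_component[OF G D]) (auto simp: V_def edge_zero)
    moreover have "\<exists>f. rooted_iso f (rep_rtree (Ts ! i)) (induced ?G (V i) (tag_vertex i ?r))"
      using rooted_iso_tag[OF i] unfolding V_def by blast
    ultimately show ?thesis
      using abs_rtree_eq_iff[OF rooted_tree_rep rooted_tree_root_component[OF G D], of "Ts ! i"]
      by (simp add: branch_def)
  qed
  have "Crls bullet X (B_plus Ts) = (\<Prod>C\<in>components_in (edges ?G) (\<Union>i<?n. V i). X (branch ?G C))"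
    unfolding B_plus_def Crls_bullet_abs[OF G] V ..
  also have "\<dots> = (\<Prod>i<?n. \<Prod>C\<in>components_in (edges ?G) (V i). X (branch ?G C))"
  proof (rule prod_components_in_UN)
    show "finite (V i)" for i by (simp add: V_def)
    show "V i \<inter> V j = {}" if "i \<noteq> j" for i j using that by (auto simp: V_def)
  qed (use edge in auto)
  also have "\<dots> = (\<Prod>i<?n. X (Ts ! i))"
    by (intro prod.cong) (simp_all add: comp branch)
  also have "\<dots> = (\<Prod>T\<leftarrow>Ts. X T)"
    by (simp add: prod.list_conv_set_nth atLeast0LessThan)
  finally show ?thesis .
qed

text \<open>Needed for the zero case of \<open>graft_bullet\<close>: a tree that is no
  \<open>B_plus [T1]\<close> cannot have exactly one branch.\<close>

lemma B_plus_single_branch: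
  assumes G: "rooted_tree G" and C: "root_components G = {C}"
  shows "abs_rtree G = B_plus [branch G C]"
proof -
  let ?r = "root_vertex G" and ?H = "induced G C (closest G C)" and ?T = "branch G C"
  have CD: "C \<in> root_components G" using C by simp
  have V: "verts G = insert ?r C" "?r \<notin> C"
    using Union_root_components[OF G] C rooted_treeD(2)[OF G] by auto
  have H: "rooted_tree ?H" by (rule rooted_tree_root_component[OF G CD])
  obtain f where f: "rooted_iso f ?H (rep_rtree ?T)"
    using abs_rtree_eq_iff[OF H rooted_tree_rep, of ?T] by (auto simp: branch_def)
  note f' = rooted_isoD[OF f, simplified]
  define F where "F = (\<lambda>v. if v = ?r then 0 else tag_vertex 0 (f v))"
  have FC: "F v = tag_vertex 0 (f v)" if "v \<in> C" for v using that V by (auto simp: F_def)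
  have Fr: "F ?r = 0" by (simp add: F_def)
  have VT: "verts (grafted [?T]) = insert 0 (tag_vertex 0 ` verts (rep_rtree ?T))"
    by (auto simp: verts_grafted)
  have "F ` C = tag_vertex 0 ` verts (rep_rtree ?T)"
    using FC f'(2) by (force simp: image_iff)
  then have img: "F ` verts G = verts (grafted [?T])" by (simp add: V Fr VT)
  have inj: "inj_on F (verts G)"
    using f'(1) FC by (auto simp: V Fr inj_on_def)
  have e1: "{?r, v} \<in> edges G \<longleftrightarrow> {0, F v} \<in> edges (grafted [?T])" if v: "v \<in> C" for v
  proof -
    have "{?r, v} \<in> edges G \<longleftrightarrow> v = closest G C"
      using root_edge_closest(1)[OF G CD] closest_root_component[OF G CD v] by metis
    also have "\<dots> \<longleftrightarrow> f v = f (closest G C)"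
      using f'(1) v root_edge_closest(2)[OF G CD] by (auto dest: inj_onD)
    finally show ?thesis by (simp add: FC[OF v] edge_zero f'(3))
  qed
  have e2: "{u, v} \<in> edges G \<longleftrightarrow> {F u, F v} \<in> edges (grafted [?T])" if "u \<in> C" "v \<in> C" for u v
    using f'(4)[OF that] that by (simp add: FC edge_tag_tag induced_def)
  have e0: "{?r} \<notin> edges G" using rooted_treeD(5)[OF G, of ?r ?r] by auto
  have e0': "{0} \<notin> edges (grafted [?T])" using edge_zero[of 0 "[?T]"] by auto
  have "{u, v} \<in> edges G \<longleftrightarrow> {F u, F v} \<in> edges (grafted [?T])" if "u \<in> verts G" "v \<in> verts G" for u v
    using that e0 e0' e1 e2 unfolding V(1) by (auto simp: Fr insert_commute[of _ ?r] insert_commute[of _ 0])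
  then have "rooted_iso F G (grafted [?T])"
    using img inj by (simp add: rooted_iso_def bij_betw_def Fr)
  then show ?thesis
    unfolding B_plus_def using abs_rtree_eq_iff[OF G rooted_tree_grafted] by blast
qed

lemma B_plus_single_cases:
  obtains (single) T1 where "T = B_plus [T1]"
  | (other) "\<And>T1. T \<noteq> B_plus [T1]" "card (root_components (rep_rtree T)) \<noteq> 1"
proof (cases "card (root_components (rep_rtree T)) = 1")
  case True
  then obtain C where "root_components (rep_rtree T) = {C}" by (auto simp: card_1_singleton_iff)
  then show ?thesis using B_plus_single_branch[OF rooted_tree_rep, of T C] single by simp
next
  case False
  then show ?thesis using single other by blast
qed

text \<open>Each summand is an integer multiple of a value of \<open>A\<close>, which every additive
  map respects. So one lemma serves \<open>Psi\<close>, composition with \<open>shift\<close>,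
  evaluation at 0 and \<open>inv_q\<close>, although \<open>inv_q\<close> is not linear over the
  field.\<close>

lemma Crls_additive:
  assumes h: "\<And>x y. h (x + y) = h x + h y"
  shows "h (Crls A (\<lambda>T. of_int (b T)) T) = Crls (\<lambda>T. h (A T)) (\<lambda>T. of_int (b T)) T"
proof -
  interpret additive h by standard (rule h)
  have "h (x * of_nat n) = h x * of_nat n" for x n
    by (induction n) (simp_all add: zero add distrib_left)
  then have int: "h (x * of_int k) = h x * of_int k" for x k
    by (cases k rule: int_cases2) (simp_all add: minus)
  show ?thesis
    unfolding Crls_rep Crls_graph_def sum by (simp add: int flip: of_int_prod)
qed

lemma bullet_of_int:
  "bullet = (\<lambda>T. of_int (if T = one_vertex then 1 else 0))"
  "- bullet = (\<lambda>T. of_int (if T = one_vertex then - 1 else 0))"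
  by (auto simp: bullet_def)

lemma Crls_minus_bullet_additive:
  assumes "\<And>x y. h (x + y) = h x + h y"
  shows "h (Crls A (- bullet) T) = Crls (\<lambda>T. h (A T)) (- bullet) T"
  using Crls_additive[OF assms, of A "\<lambda>T. if T = one_vertex then - 1 else 0" T]
  by (simp only: bullet_of_int(2))

lemma Crls_bullet_additive:
  assumes "\<And>x y. h (x + y) = h x + h y"
  shows "h (Crls A bullet T) = Crls (\<lambda>T. h (A T)) bullet T"
  using Crls_additive[OF assms, of A "\<lambda>T. if T = one_vertex then 1 else 0" T]
  by (simp only: bullet_of_int(1))

lemma Crls_diff_left: "Crls (\<lambda>T. A T - A' T) B T = Crls A B T - Crls A' B T"
  by (simp add: Crls_rep Crls_graph_def algebra_simps sum_subtractf)

lemma Crls_add_left: "Crls (\<lambda>T. A T + A' T) B T = Crls A B T + Crls A' B T"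
  by (simp add: Crls_rep Crls_graph_def algebra_simps sum.distrib)

lemma Crls_mult_left: "Crls (\<lambda>T. c * A T) B T = c * Crls A B T"
  by (simp add: Crls_rep Crls_graph_def sum_distrib_left mult.assoc)

lemma Crls_bullet_rep:
  "Crls bullet X T = (\<Prod>C\<in>root_components (rep_rtree T). X (branch (rep_rtree T) C))"
  using Crls_bullet_root_components[OF rooted_tree_rep] by simp

lemma finite_root_components_rep [simp]: "finite (root_components (rep_rtree T))"
  by (rule finite_root_components) simp

lemma Crls_bullet_hom:
  assumes "h 1 = 1" "\<And>x y. h (x * y) = h x * h y"
  shows "h (Crls bullet X T) = Crls bullet (\<lambda>T. h (X T)) T"
proof -
  have "h (\<Prod>C\<in>K. Z C) = (\<Prod>C\<in>K. h (Z C))" if "finite K" for K :: "nat set set" and Z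
    using that by (induction K) (simp_all add: assms)
  then show ?thesis by (simp add: Crls_bullet_rep)
qed

lemma tsize_one_vertex: "tsize one_vertex = 1"
  unfolding one_vertex_def by (simp add: tsize_abs rooted_tree_single)

text \<open>The branches have \<open>tsize T - 1\<close> vertices in all; the factor
  \<open>a\<close> on the left accounts for the root.\<close>

lemma Crls_bullet_power_tsize:
  "a * Crls bullet (\<lambda>T. a ^ tsize T * B T) T = a ^ tsize T * Crls bullet B T"
proof -
  have "(\<lambda>T. a ^ tsize T * bullet T) = (\<lambda>T. a * bullet T)"
    by (auto simp: bullet_def tsize_one_vertex)
  then show ?thesis using Crls_power_tsize[of a bullet B T] by (simp add: Crls_mult_left)
qed

lemma Crls_bullet_one: "Crls bullet (\<lambda>_. 1) = (\<lambda>_. 1)"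
  by (simp add: Crls_bullet_rep fun_eq_iff)

lemma Crls_bullet_zero: "Crls bullet (\<lambda>_. 0) T = bullet T"
proof -
  have "root_components (rep_rtree T) = {} \<longleftrightarrow> T = one_vertex"
    using one_vertex_iff[OF rooted_tree_rep, of T] root_rep[of T]
    by (auto simp: root_components_def components_in_def)
  then show ?thesis by (cases "T = one_vertex") (simp_all add: Crls_bullet_rep bullet_def power_0_left)
qed

text \<open>The constant series 1 is \<open>Crls bullet\<close> of itself. By the composition law
  and induction on the smaller branches, the claim reduces to \<open>Crls bullet\<close> of the zero
  series.\<close>

lemma Crls_minus_bullet_one: "Crls (\<lambda>_. 1::'a::comm_ring_1) (- bullet) T = bullet T"
proof (induction T rule: measure_induct_rule[of tsize])
  case (less T)
  have "Crls (\<lambda>_. 1::'a) (- bullet) T = Crls (Crls bullet (\<lambda>_. 1)) (- bullet) T"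
    by (simp add: Crls_bullet_one)
  also have "\<dots> = Crls bullet (Crls (\<lambda>_. 1) (- bullet) + - bullet) T"
    by (simp only: Crls_Crls_bullet)
  also have "\<dots> = Crls bullet (\<lambda>_. 0) T"
  proof (rule Crls_cong_right)
    fix T' assume "tsize T' < tsize T"
    from less[OF this] show "(Crls (\<lambda>_. 1::'a) (- bullet) + - bullet) T' = 0"
      unfolding plus_fun_def fun_Compl_def by (metis add.right_inverse)
  qed
  finally show ?case unfolding Crls_bullet_zero .
qed

text \<open>Two or more factors vanishing at 0 kill the derivative, the empty product is constant,
  and a single factor keeps its own derivative.\<close>

lemma pderiv_Crls_bullet_0:
  fixes f :: "'a::idom poly tree_series"
  assumes f: "\<And>T. poly (f T) 0 = 0"
  shows "poly (pderiv (Crls bullet f T)) 0 = graft_bullet (\<lambda>T. poly (pderiv (f T)) 0) T"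
proof (cases T rule: B_plus_single_cases)
  case (single T1)
  then show ?thesis by (simp add: Crls_bullet_B_plus graft_bullet_B_plus)
next
  case other
  let ?K = "root_components (rep_rtree T)" and ?f = "\<lambda>C. f (branch (rep_rtree T) C)"
  have "poly (pderiv (\<Prod>C\<in>?K. ?f C)) 0 = 0"
  proof (cases "?K = {}")
    case False
    then obtain C where C: "C \<in> ?K" by blast
    have "?K \<noteq> {C}" using other by auto
    then obtain D where D: "D \<in> ?K - {C}" using C by blast
    have "(\<Prod>C\<in>?K. ?f C) = ?f C * (?f D * (\<Prod>C\<in>?K - {C} - {D}. ?f C))"
      using C D by (simp add: prod.remove[of ?K C] prod.remove[of "?K - {C}" D])
    then show ?thesis by (simp add: pderiv_mult f)
  qed simp
  then show ?thesis using other by (simp add: Crls_bullet_rep graft_bullet_def)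
qed

section \<open>The linear form \<open>\<Psi>\<close>\<close>

definition shift :: "ratq poly" where
  "shift = [:1, qq:]"

text \<open>This is \<open>shift - [:0, 1:]\<close>; its zero is the fixed point of
  \<open>shift\<close>.\<close>

definition slope :: "ratq poly" where
  "slope = [:1, qq - 1:]"

lemma qq_power_eq_1_iff: "qq ^ n = 1 \<longleftrightarrow> n = 0"
  using qq_power_neq_1[of n] by (cases "n = 0") auto

lemma linear_functional_eq_0:
  fixes E :: "'a::comm_ring_1 poly \<Rightarrow> 'a"
  assumes add: "\<And>p r. E (p + r) = E p + E r" and smult: "\<And>c p. E (smult c p) = c * E p"
    and "\<And>n. E ([:0, 1:] ^ n) = 0"
  shows "E p = 0"
proof -
  interpret additive E by standard (rule add)
  have "E p = E (\<Sum>i\<le>degree p. monom (coeff p i) i)" by (simp add: poly_as_sum_of_monoms)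
  also have "\<dots> = 0" by (simp add: sum monom_altdef smult assms(3))
  finally show ?thesis .
qed

lemma pcompose_power: "pcompose (p ^ n) r = pcompose p r ^ n"
  by (induction n) (simp_all add: pcompose_1 pcompose_mult)

lemma pcompose_shift_power:
  "pcompose ([:0, 1:] ^ n) shift = (\<Sum>k\<le>n. smult (of_nat (n choose k) * qq ^ k) ([:0, 1:] ^ k))"
proof -
  have "pcompose ([:0, 1:] ^ n) shift = (smult qq [:0, 1:] + 1) ^ n"
    by (simp add: pcompose_power pcompose_idR shift_def pcompose_pCons one_pCons)
  also have "\<dots> = (\<Sum>k\<le>n. of_nat (n choose k) * smult qq [:0, 1:] ^ k)"
    by (simp only: binomial_ring power_one mult_1_right)
  also have "\<dots> = (\<Sum>k\<le>n. smult (of_nat (n choose k) * qq ^ k) ([:0, 1:] ^ k))"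
    by (simp only: of_nat_poly smult_power) (simp add: mult.commute)
  finally show ?thesis .
qed

lemma Psi_additive: "additive Psi"
  by standard (rule Psi_linear)

lemma Psi_sum: "Psi (\<Sum>i\<in>I. p i) = (\<Sum>i\<in>I. Psi (p i))"
  using additive.sum[OF Psi_additive] .

text \<open>On x^n with n > 0 this is the defining recursion, with (1 + q x)^n expanded. The
  recursion says nothing for n = 0, where the value q - 1 produces the term with
  \<open>poly p 0\<close>.\<close>

lemma Psi_pcompose_shift:
  "qq * Psi (pcompose p shift) - Psi p = (qq - 1) * poly p 0 + poly (pderiv p) 0"
proof -
  define E where "E = (\<lambda>p. qq * Psi (pcompose p shift) - Psi p - ((qq - 1) * poly p 0 + poly (pderiv p) 0))"
  have "E ([:0, 1:] ^ n) = 0" for n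
  proof -
    have bc: "is_bernoulli_carlitz bernoulli_carlitz"
      unfolding bernoulli_carlitz_def using ex1_bernoulli_carlitz by (rule theI')
    have b: "qq * (\<Sum>k\<le>n. of_nat (n choose k) * qq ^ k * bernoulli_carlitz k) - bernoulli_carlitz n =
        (if n = 1 then 1 else 0)" if "n \<noteq> 0"
      using bc[unfolded is_bernoulli_carlitz_def, THEN conjunct2, THEN spec, of n] that by simp
    have b0: "bernoulli_carlitz 0 = 1" using bc by (simp add: is_bernoulli_carlitz_def)
    have "Psi (pcompose ([:0, 1:] ^ n) shift) = (\<Sum>k\<le>n. of_nat (n choose k) * qq ^ k * bernoulli_carlitz k)"
      unfolding pcompose_shift_power Psi_sum Psi_linear Psi_power ..
    moreover have "poly ([:0, 1:] ^ n) (0::ratq) = (if n = 0 then 1 else 0)" by (simp add: power_0_left)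
    moreover have "poly (pderiv ([:0, 1:] ^ n)) (0::ratq) = (if n = 1 then 1 else 0)"
      by (cases n) (auto simp: pderiv_power_Suc pderiv_pCons power_0_left)
    ultimately show ?thesis
      using b b0 unfolding E_def Psi_power by (cases "n = 0") simp_all
  qed
  moreover have "E (p + r) = E p + E r" for p r
    by (simp add: E_def pcompose_add Psi_linear pderiv_add algebra_simps)
  moreover have "E (smult c p) = c * E p" for c p
    by (simp add: E_def pcompose_smult Psi_linear pderiv_smult algebra_simps)
  ultimately have "E p = 0" by (rule linear_functional_eq_0[rotated 2])
  then show ?thesis by (simp add: E_def)
qed

lemma slope_dvd: "slope dvd pcompose p shift - p"
proof (induction p)
  case (pCons a p)
  \<comment> \<open>Product rule for differences applied to a + x p: \<open>shift\<close> changes x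
    by \<open>slope\<close>.\<close>
  have "pcompose (pCons a p) shift - pCons a p = shift * (pcompose p shift - p) + slope * p"
  proof -
    have "slope * p = shift * p - pCons 0 p" by (simp add: shift_def slope_def smult_diff_left)
    moreover have "pcompose (pCons a p) shift = [:a:] + shift * pcompose p shift"
      by (simp add: pcompose_pCons)
    ultimately show ?thesis by (simp add: right_diff_distrib)
  qed
  then show ?case using pCons by simp
qed simp

lemma pcompose_slope_shift: "pcompose slope shift = smult qq slope"
  by (simp add: slope_def shift_def pcompose_pCons algebra_simps)

text \<open>\<open>x \<mapsto> 1 + q x\<close> leaves \<open>p \<mapsto> \<Psi>((p(1 + q x) - p) / (1 + (q - 1) x)) - p'(0)\<close> invariant, and an
  invariant linear form that is zero at \<open>1\<close> vanishes on all powers of \<open>x\<close>, as \<open>q\<^sup>n \<noteq> 1\<close>.\<close>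

lemma Psi_difference_quotient:
  assumes "pcompose p shift - p = slope * g"
  shows "Psi g = poly (pderiv p) 0"
proof -
  define D where "D = (\<lambda>p. (pcompose p shift - p) div slope)"
  have slope0: "slope \<noteq> 0" by (simp add: slope_def)
  have D: "slope * D p = pcompose p shift - p" for p
    using slope_dvd[of p] by (simp add: D_def)
  have DI: "D p = g" if "pcompose p shift - p = slope * g" for p g
    using that D[of p] slope0 by simp
  define E where "E = (\<lambda>p. Psi (D p) - poly (pderiv p) 0)"
  have add: "E (p + r) = E p + E r" for p r
  proof -
    have "D (p + r) = D p + D r"
      by (rule DI) (simp add: distrib_left D pcompose_add)
    then show ?thesis by (simp add: E_def Psi_linear pderiv_add)
  qed
  have smult: "E (smult c p) = c * E p" for c p
  proof -
    have "D (smult c p) = smult c (D p)"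
      by (rule DI) (simp add: D pcompose_smult smult_diff_right)
    then show ?thesis by (simp add: E_def Psi_linear pderiv_smult algebra_simps)
  qed
  have inv: "E (pcompose p shift) = E p" for p
  proof -
    \<comment> \<open>The factor q comes from composing \<open>slope\<close> with
      \<open>shift\<close>. It matches the q in \<open>Psi_pcompose_shift\<close>, which is then
      applied to \<open>D p\<close>.\<close>
    have "D (pcompose p shift) = smult qq (pcompose (D p) shift)"
    proof (rule DI)
      have "pcompose (pcompose p shift) shift - pcompose p shift = pcompose (slope * D p) shift"
        by (simp add: D pcompose_diff)
      then show "pcompose (pcompose p shift) shift - pcompose p shift =
          slope * smult qq (pcompose (D p) shift)"
        by (simp add: pcompose_mult pcompose_slope_shift)
    qed
    then have "Psi (D (pcompose p shift)) - Psi (D p) = (qq - 1) * poly (D p) 0 + poly (pderiv (D p)) 0"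
      using Psi_pcompose_shift[of "D p"] by (simp add: Psi_linear)
    \<comment> \<open>At 0 \<open>slope\<close> has value 1 and derivative q - 1, so the right-hand
      side of the recursion is exactly this product rule.\<close>
    also have "\<dots> = poly (pderiv (slope * D p)) 0"
      by (simp add: pderiv_mult) (simp add: slope_def pderiv_pCons)
    also have "\<dots> = poly (pderiv (pcompose p shift)) 0 - poly (pderiv p) 0"
      by (simp add: D pderiv_diff)
    finally show ?thesis by (simp add: E_def algebra_simps)
  qed
  interpret additive E by standard (rule add)
  have "E ([:0, 1:] ^ n) = 0" for n
  proof (induction n rule: less_induct)
    case (less n)
    show ?case
    proof (cases "n = 0")
      case True
      have "D 1 = 0" by (rule DI) (simp add: pcompose_1)
      then show ?thesis using True additive.zero[OF Psi_additive] by (simp add: E_def)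
    next
      case False
      let ?t = "\<lambda>k. of_nat (n choose k) * qq ^ k * E ([:0, 1:] ^ k)"
      have "E ([:0, 1:] ^ n) = (\<Sum>k\<le>n. ?t k)"
        using inv[of "[:0, 1:] ^ n"] unfolding pcompose_shift_power sum smult by simp
      also have "\<dots> = (\<Sum>k<n. ?t k) + ?t n" by (simp add: lessThan_Suc_atMost[symmetric])
      also have "(\<Sum>k<n. ?t k) = 0" using less by simp
      finally have E: "E ([:0, 1:] ^ n) = ?t n" by (metis add_0)
      have "(qq ^ n - 1) * E ([:0, 1:] ^ n) = ?t n - E ([:0, 1:] ^ n)" by (simp add: left_diff_distrib)
      then have "(qq ^ n - 1) * E ([:0, 1:] ^ n) = 0" using E by (metis diff_self)
      then show ?thesis using False by (simp add: qq_power_eq_1_iff)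
    qed
  qed
  then have "E p = 0" by (rule linear_functional_eq_0[OF add smult])
  then show ?thesis using DI[OF assms] by (simp add: E_def)
qed

section \<open>The series \<open>\<S>\<close>\<close>

text \<open>The coefficients of q times the suspension of \<open>S_series\<close> by q: the outer q
  completes the exponent \<open>tsize T - 1\<close>.\<close>

definition S_scaled :: "ratq poly tree_series" where
  "S_scaled T = smult (qq ^ tsize T) (S_series T)"

definition S_reduced :: "ratq poly tree_series" where
  "S_reduced T = Crls S_series (- bullet) T - bullet T"

lemma tscale_suspension: "tscale c (suspension c A) T = c ^ tsize T * A T"
  by (cases "tsize T") (use tsize_pos[of T] in \<open>auto simp: tscale_def suspension_def mult_ac\<close>)

lemma S_reduced_eq: "S_reduced T = S_scaled T - smult qq slope * Crls bullet S_scaled T"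
proof -
  have S: "is_S S_series" unfolding S_series_def using ex1_S by (rule theI')
  have scaled: "tscale [:qq:] (suspension [:qq:] S_series) = S_scaled"
    by (rule ext) (simp add: tscale_suspension S_scaled_def poly_const_pow)
  have "[:qq:] * (1 + ([:qq:] - 1) * [:0, 1:]) = smult qq slope"
    by (simp add: slope_def one_pCons)
  then have "S_scaled T - Crls S_series (- bullet) T = smult qq slope * Crls bullet S_scaled T - bullet T"
    using fun_cong[OF S[unfolded is_S_def scaled], of T]
    by (simp only: minus_apply tscale_def)
  then show ?thesis by (simp add: S_reduced_def algebra_simps)
qed

lemma smult_Crls_bullet_S_scaled:
  "smult qq (Crls bullet (\<lambda>T. smult (qq ^ tsize T) (A T)) T) = smult (qq ^ tsize T) (Crls bullet A T)"
  using Crls_bullet_power_tsize[of "[:qq:]" A T] by (simp add: poly_const_pow)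

lemma pcompose_shift_Crls_bullet:
  "pcompose (Crls bullet A T) shift = Crls bullet (\<lambda>T. pcompose (A T) shift) T"
  by (rule Crls_bullet_hom) (simp_all add: pcompose_1 pcompose_mult)

lemma pcompose_bullet: "pcompose (bullet T) p = bullet T"
  by (simp add: bullet_def pcompose_1)

text \<open>The defect of the difference equation for \<open>S_series\<close> is computed in two ways, from the
  two expressions for \<open>S_reduced\<close>; they differ by the factor \<open>q\<^sup>n\<close>, so the defect vanishes.\<close>

definition S_defect :: "ratq poly tree_series" where
  "S_defect T = pcompose (S_series T) shift - S_series T
     - smult qq slope * Crls bullet (\<lambda>T. pcompose (S_series T) shift) T"

text \<open>Composition with \<open>shift\<close> multiplies \<open>slope\<close> by q. This q and
  those in the scaled branches make up q^n, n being \<open>tsize T\<close>, which then factors out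
  of all terms.\<close>

lemma pcompose_S_reduced_defect:
  "pcompose (S_reduced T) shift = S_scaled T + smult (qq ^ tsize T) (S_defect T)"
proof -
  let ?P = "Crls bullet (\<lambda>T. pcompose (S_series T) shift) T"
  have "pcompose (S_reduced T) shift =
      pcompose (S_scaled T) shift - smult qq slope * smult qq (Crls bullet (\<lambda>T. pcompose (S_scaled T) shift) T)"
    unfolding S_reduced_eq
    by (simp add: pcompose_diff pcompose_mult pcompose_smult pcompose_slope_shift pcompose_shift_Crls_bullet)
  also have "smult qq (Crls bullet (\<lambda>T. pcompose (S_scaled T) shift) T) = smult (qq ^ tsize T) ?P"
    by (simp add: S_scaled_def pcompose_smult smult_Crls_bullet_S_scaled)
  finally show ?thesis
    by (simp add: S_scaled_def S_defect_def pcompose_smult smult_diff_right mult.commute)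
qed

text \<open>The change of \<open>Crls S_series (- bullet) T\<close> under \<open>shift\<close>
  consists of a defect term, where only \<open>T\<close> itself survives the induction, and a
  product over smaller branches, on which \<open>S_reduced\<close> composed with
  \<open>shift\<close> is \<open>S_scaled\<close>. So the defect has coefficient 1 here, against q^n
  in \<open>pcompose_S_reduced_defect\<close>.\<close>

lemma S_defect_eq_0: "S_defect T = 0"
proof (induction T rule: measure_induct_rule[of tsize])
  case (less T)
  let ?A = "\<lambda>T. pcompose (S_series T) shift"
  have "pcompose (S_reduced T) shift = Crls ?A (- bullet) T - bullet T"
    unfolding S_reduced_def pcompose_diff pcompose_bullet
    by (subst Crls_minus_bullet_additive) (simp_all add: pcompose_add)
  then have "pcompose (S_reduced T) shift - S_reduced T = Crls (\<lambda>T. ?A T - S_series T) (- bullet) T"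
    by (simp add: S_reduced_def Crls_diff_left)
  also have "(\<lambda>T. ?A T - S_series T) = (\<lambda>T. S_defect T + smult qq slope * Crls bullet ?A T)"
    by (simp add: S_defect_def)
  also have "Crls \<dots> (- bullet) T = Crls S_defect (- bullet) T + smult qq slope * Crls (Crls bullet ?A) (- bullet) T"
    by (simp only: Crls_add_left Crls_mult_left)
  also have "Crls S_defect (- bullet) T = S_defect T"
  proof -
    have "Crls_lower S_defect (- bullet) T = Crls_lower (\<lambda>_. 0) (- bullet) T"
      by (rule Crls_lower_cong) (rule less.IH)
    also have "\<dots> = 0" by (simp add: Crls_lower_def Let_def)
    finally show ?thesis by (simp add: Crls_split)
  qed
  also have "Crls (Crls bullet ?A) (- bullet) T = Crls bullet S_scaled T"
    unfolding Crls_Crls_bullet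
  proof (rule Crls_cong_right)
    fix T' assume T': "tsize T' < tsize T"
    have "(Crls ?A (- bullet) + - bullet) T' = pcompose (S_reduced T') shift"
      unfolding S_reduced_def pcompose_diff pcompose_bullet
      by (subst Crls_minus_bullet_additive) (simp_all add: pcompose_add plus_fun_def fun_Compl_def)
    also have "\<dots> = S_scaled T'" by (simp add: pcompose_S_reduced_defect less.IH[OF T'])
    finally show "(Crls ?A (- bullet) + - bullet) T' = S_scaled T'" .
  qed
  finally have "pcompose (S_reduced T) shift = S_scaled T + S_defect T"
    using S_reduced_eq[of T] by simp
  then have "smult (qq ^ tsize T - 1) (S_defect T) = 0"
    by (simp add: pcompose_S_reduced_defect smult_diff_left)
  then show ?case using qq_power_neq_1[OF tsize_pos] by simp
qed

lemma pcompose_S_reduced: "pcompose (S_reduced T) shift = S_scaled T"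
  by (simp add: pcompose_S_reduced_defect S_defect_eq_0)

lemma poly_0_Crls_bullet: "poly (Crls bullet A T) a = Crls bullet (\<lambda>T. poly (A T) a) T"
  by (rule Crls_bullet_hom) simp_all

lemma poly_S_0_aux:
  "poly (S_reduced T) 0 = qq ^ tsize T * (poly (S_series T) 0 - Crls bullet (\<lambda>T. poly (S_series T) 0) T)"
proof -
  have "smult qq slope * Crls bullet S_scaled T = slope * smult (qq ^ tsize T) (Crls bullet S_series T)"
    unfolding smult_Crls_bullet_S_scaled[of S_series T, folded S_scaled_def, symmetric] by simp
  then show ?thesis
    by (simp add: S_reduced_eq S_scaled_def poly_0_Crls_bullet algebra_simps) (simp add: slope_def)
qed

text \<open>Two values of \<open>S_reduced T\<close> at 0 are compared. If s is the constant term at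
  \<open>T\<close> and all smaller trees have constant term 1, \<open>poly_S_0_aux\<close> gives q^n
  (s - 1), while the definition and \<open>Crls_minus_bullet_one\<close> give s - 1.\<close>

lemma poly_S_series_0: "poly (S_series T) 0 = 1"
proof (induction T rule: measure_induct_rule[of tsize])
  case (less T)
  let ?s = "\<lambda>T. poly (S_series T) 0"
  have "Crls bullet ?s T = Crls bullet (\<lambda>_. 1) T"
    by (rule Crls_cong_right) (rule less.IH)
  then have 1: "poly (S_reduced T) 0 = qq ^ tsize T * (?s T - 1)"
    by (simp add: poly_S_0_aux Crls_bullet_one)
  have "poly (S_reduced T) 0 = Crls ?s (- bullet) T - bullet T"
    unfolding S_reduced_def poly_diff by (subst Crls_minus_bullet_additive) (simp_all add: bullet_def)
  also have "Crls ?s (- bullet) T = ?s T + Crls_lower (\<lambda>_. 1) (- bullet) T"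
    unfolding Crls_split by (intro arg_cong2[where f = "(+)"] refl Crls_lower_cong less.IH)
  also have "\<dots> = ?s T - 1 + bullet T"
    using Crls_split[of "\<lambda>_. 1::ratq" "- bullet" T] Crls_minus_bullet_one[of T, where ?'a = ratq] by simp
  finally have "(qq ^ tsize T - 1) * (?s T - 1) = 0" using 1 by (simp add: left_diff_distrib)
  then show ?case using qq_power_neq_1[OF tsize_pos] by simp
qed

lemma poly_S_reduced_0: "poly (S_reduced T) 0 = 0"
  by (simp add: poly_S_0_aux poly_S_series_0 Crls_bullet_one)

text \<open>By \<open>Crls_bullet_B_plus\<close> this is the claimed value at
  \<open>B_plus Ts\<close>; written with \<open>Crls bullet\<close> it is open to the composition
  law.\<close>

definition Psi_S :: "ratq tree_series" where
  "Psi_S T = Psi (Crls bullet S_series T)"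

lemma Psi_S_reduced: "poly (pderiv (S_reduced T)) 0 = qq ^ tsize T * Psi_S T"
proof -
  have "pcompose (S_reduced T) shift - S_reduced T = slope * smult qq (Crls bullet S_scaled T)"
    unfolding pcompose_S_reduced by (simp add: S_reduced_eq)
  then have "poly (pderiv (S_reduced T)) 0 = Psi (smult qq (Crls bullet S_scaled T))"
    using Psi_difference_quotient by metis
  also have "\<dots> = Psi (smult (qq ^ tsize T) (Crls bullet S_series T))"
    using smult_Crls_bullet_S_scaled[of S_series T] by (simp flip: S_scaled_def)
  finally show ?thesis by (simp add: Psi_linear Psi_S_def)
qed

text \<open>The equation of \<open>Omega\<close> after \<open>q \<mapsto> 1/q\<close> and \<open>suspension (- 1 / qq)\<close>; it moves the
  signs of the scaling from \<open>W\<close> to \<open>bullet\<close>.\<close>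

definition is_Omega_bar :: "ratq tree_series \<Rightarrow> bool" where
  "is_Omega_bar W \<longleftrightarrow> (\<forall>T. qq ^ tsize T * W T - Crls W (- bullet) T =
     (qq - 1) * bullet T + graft_bullet (\<lambda>T. qq ^ tsize T * W T) T)"

lemma is_Omega_bar_Psi_S: "is_Omega_bar Psi_S"
  unfolding is_Omega_bar_def
proof
  fix T
  let ?\<phi> = "Crls bullet S_reduced T"
  have "qq ^ tsize T * Psi_S T = Psi (smult qq (Crls bullet S_scaled T))"
    using smult_Crls_bullet_S_scaled[of S_series T] unfolding Psi_S_def
    by (simp flip: S_scaled_def Psi_linear)
  also have "Crls bullet S_scaled T = pcompose ?\<phi> shift"
    by (simp add: pcompose_shift_Crls_bullet pcompose_S_reduced)
  finally have 1: "qq ^ tsize T * Psi_S T = qq * Psi (pcompose ?\<phi> shift)"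
    by (simp add: Psi_linear)
  have "Crls Psi_S (- bullet) T = Psi (Crls (Crls bullet S_series) (- bullet) T)"
    unfolding Psi_S_def by (rule Crls_minus_bullet_additive[symmetric]) (rule Psi_linear)
  \<comment> \<open>The composition law yields \<open>Crls S_series (- bullet) - bullet\<close> on
    the branches, which is why \<open>S_reduced\<close> subtracts \<open>bullet\<close>.\<close>
  also have "Crls (Crls bullet S_series) (- bullet) T = ?\<phi>"
  proof -
    have "Crls S_series (- bullet) + - bullet = S_reduced"
      by (auto simp: S_reduced_def plus_fun_def fun_Compl_def)
    then show ?thesis by (simp add: Crls_Crls_bullet)
  qed
  finally have 2: "Crls Psi_S (- bullet) T = Psi ?\<phi>" .
  have "poly ?\<phi> 0 = bullet T"
    by (simp add: poly_0_Crls_bullet poly_S_reduced_0 Crls_bullet_zero)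
  moreover have "poly (pderiv ?\<phi>) 0 = graft_bullet (\<lambda>T. qq ^ tsize T * Psi_S T) T"
    by (simp add: pderiv_Crls_bullet_0 poly_S_reduced_0 Psi_S_reduced)
  ultimately show "qq ^ tsize T * Psi_S T - Crls Psi_S (- bullet) T =
      (qq - 1) * bullet T + graft_bullet (\<lambda>T. qq ^ tsize T * Psi_S T) T"
    unfolding 1 2 by (simp add: Psi_pcompose_shift)
qed

text \<open>The unknown at \<open>T\<close> has coefficient q^n - 1; all other terms involve smaller
  trees only, as \<open>graft_bullet\<close> reads the value at the single branch.\<close>

lemma is_Omega_bar_unique:
  assumes V: "is_Omega_bar V" and W: "is_Omega_bar W"
  shows "V T = W T"
proof (induction T rule: measure_induct_rule[of tsize])
  case (less T)
  have *: "(qq ^ tsize T - 1) * X T = Crls_lower X (- bullet) T + (qq - 1) * bullet T +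
      graft_bullet (\<lambda>T. qq ^ tsize T * X T) T" if "is_Omega_bar X" for X
    using that[unfolded is_Omega_bar_def, THEN spec, of T] by (simp add: Crls_split algebra_simps)
  have "Crls_lower V (- bullet) T = Crls_lower W (- bullet) T"
    by (rule Crls_lower_cong) (rule less.IH)
  moreover have "graft_bullet (\<lambda>T. qq ^ tsize T * V T) T = graft_bullet (\<lambda>T. qq ^ tsize T * W T) T"
  proof (cases T rule: B_plus_single_cases)
    case (single T1)
    then show ?thesis using less.IH[of T1] by (simp add: graft_bullet_B_plus tsize_B_plus_single)
  qed (simp add: graft_bullet_def)
  ultimately have "(qq ^ tsize T - 1) * V T = (qq ^ tsize T - 1) * W T"
    unfolding *[OF V] *[OF W] by simp
  then show ?case using qq_power_neq_1[OF tsize_pos, of T] by simp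
qed

section \<open>Substitution of \<open>1/q\<close>\<close>

definition eval_inv_q :: "rat poly \<Rightarrow> ratq" where
  "eval_inv_q p = poly (map_poly (\<lambda>c. to_fract [:c:]) p) (1 / qq)"

lemma eval_inv_q_pCons: "eval_inv_q (pCons a p) = to_fract [:a:] + eval_inv_q p / qq"
  by (simp add: eval_inv_q_def map_poly_pCons)

lemma eval_inv_q_0 [simp]: "eval_inv_q 0 = 0"
  by (simp add: eval_inv_q_def)

lemma eval_inv_q_1 [simp]: "eval_inv_q 1 = 1"
  using eval_inv_q_pCons[of 1 0] by (simp add: one_pCons[symmetric])

lemma eval_inv_q_add: "eval_inv_q (p + r) = eval_inv_q p + eval_inv_q r"
  by (induction p r rule: poly_induct2)
    (simp_all add: eval_inv_q_pCons add_divide_distrib flip: to_fract_add)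

lemma eval_inv_q_smult: "eval_inv_q (smult c p) = to_fract [:c:] * eval_inv_q p"
  by (induction p) (simp_all add: eval_inv_q_pCons distrib_left flip: to_fract_mult)

lemma eval_inv_q_mult: "eval_inv_q (p * r) = eval_inv_q p * eval_inv_q r"
  by (induction p) (simp_all add: eval_inv_q_pCons eval_inv_q_add eval_inv_q_smult distrib_right)

lemma qq_nonzero [simp]: "qq \<noteq> 0"
  by (simp add: qq_def)

lemma qq_power: "qq ^ n = to_fract ([:0, 1:] ^ n)"
  by (induction n) (simp_all only: power_0 power_Suc to_fract_1 to_fract_mult qq_def)

text \<open>Keeps denominators nonzero under the substitution. Times q^n, n being the degree, the
  value at 1/q is the polynomial \<open>r\<close> with reversed coefficients, whose constant term is
  the leading coefficient of \<open>p\<close>.\<close>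

lemma eval_inv_q_eq_0_iff [simp]: "eval_inv_q p = 0 \<longleftrightarrow> p = 0"
proof
  assume p: "eval_inv_q p = 0"
  define n where "n = degree p"
  define r where "r = (\<Sum>i\<le>n. smult (coeff p i) ([:0, 1:] ^ (n - i)))"
  have "degree (map_poly (\<lambda>c. to_fract [:c:]) p) = n"
    by (simp add: degree_map_poly n_def)
  then have "qq ^ n * eval_inv_q p = (\<Sum>i\<le>n. qq ^ n * (to_fract [:coeff p i:] * (1 / qq) ^ i))"
    by (simp add: eval_inv_q_def poly_altdef coeff_map_poly sum_distrib_left)
  also have "\<dots> = (\<Sum>i\<le>n. to_fract [:coeff p i:] * qq ^ (n - i))"
    by (intro sum.cong) (simp_all add: power_diff field_simps)
  also have "\<dots> = to_fract r"
    unfolding r_def to_fract_sum qq_power by (simp flip: to_fract_mult)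
  finally have "r = 0" using p by simp
  then have "poly r 0 = 0" by simp
  moreover have "poly r 0 = (\<Sum>i\<le>n. if i = n then coeff p i else 0)"
    unfolding r_def poly_sum by (intro sum.cong) (auto simp: power_0_left)
  ultimately have "lead_coeff p = 0" by (simp add: n_def)
  then show "p = 0" by simp
qed simp

text \<open>\<open>inv_q\<close> reads the normalised fraction; cross multiplication shows that any
  other fraction gives the same value, from which additivity and multiplicativity follow.\<close>

lemma inv_q_divide:
  assumes "b \<noteq> 0"
  shows "inv_q (to_fract a / to_fract b) = eval_inv_q a / eval_inv_q b"
proof -
  define f where "f = to_fract a / to_fract b"
  obtain a' b' where q: "quot_of_fract f = (a', b')" by force
  have b': "b' \<noteq> 0" using snd_quot_of_fract_nonzero[of f] by (simp add: q)
  have "f = to_fract a' / to_fract b'"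
    using Fract_quot_of_fract[of f] by (simp add: q Fract_conv_to_fract)
  then have "to_fract (a' * b) = to_fract (a * b')"
    using assms b' by (simp add: f_def field_simps)
  then have "a' * b = a * b'" by (simp only: to_fract_eq_iff)
  then have "eval_inv_q a' * eval_inv_q b = eval_inv_q a * eval_inv_q b'"
    by (metis eval_inv_q_mult)
  moreover have "inv_q f = eval_inv_q a' / eval_inv_q b'"
    by (simp add: inv_q_def q eval_inv_q_def)
  ultimately show ?thesis using assms b' by (simp add: frac_eq_eq flip: f_def)
qed

lemma ratq_cases:
  fixes f :: ratq
  obtains a b where "f = to_fract a / to_fract b" "b \<noteq> 0"
  by (cases f) (auto simp: Fract_conv_to_fract)

lemma inv_q_add: "inv_q (f + g) = inv_q f + inv_q g"
proof -
  obtain a b where f: "f = to_fract a / to_fract b" "b \<noteq> 0" by (rule ratq_cases)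
  obtain c d where g: "g = to_fract c / to_fract d" "d \<noteq> 0" by (rule ratq_cases)
  have "f + g = to_fract (a * d + c * b) / to_fract (b * d)"
    using f g by (simp add: field_simps)
  then have "inv_q (f + g) = eval_inv_q (a * d + c * b) / eval_inv_q (b * d)"
    using f g by (simp only: inv_q_divide mult_eq_0_iff simp_thms)
  also have "\<dots> = inv_q f + inv_q g"
    unfolding f(1) g(1) inv_q_divide[OF f(2)] inv_q_divide[OF g(2)]
    using f(2) g(2) by (simp add: eval_inv_q_add eval_inv_q_mult field_simps)
  finally show ?thesis .
qed

lemma inv_q_mult: "inv_q (f * g) = inv_q f * inv_q g"
proof -
  obtain a b where f: "f = to_fract a / to_fract b" "b \<noteq> 0" by (rule ratq_cases)
  obtain c d where g: "g = to_fract c / to_fract d" "d \<noteq> 0" by (rule ratq_cases)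
  have "f * g = to_fract (a * c) / to_fract (b * d)"
    using f g by simp
  then have "inv_q (f * g) = eval_inv_q (a * c) / eval_inv_q (b * d)"
    using f g by (simp only: inv_q_divide mult_eq_0_iff simp_thms)
  also have "\<dots> = inv_q f * inv_q g"
    using f g by (simp add: inv_q_divide eval_inv_q_mult)
  finally show ?thesis .
qed

lemma inv_q_to_fract: "inv_q (to_fract p) = eval_inv_q p"
  using inv_q_divide[of 1 p] by simp

lemma inv_q_1: "inv_q 1 = 1"
  using inv_q_to_fract[of 1] by simp

lemma inv_q_0: "inv_q 0 = 0"
  using inv_q_to_fract[of 0] by simp

lemma inv_q_qq: "inv_q qq = 1 / qq"
proof -
  have "eval_inv_q [:0, 1:] = 1 / qq" by (simp add: eval_inv_q_pCons flip: one_pCons)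
  then show ?thesis by (metis inv_q_to_fract qq_def)
qed

lemma inv_q_diff: "inv_q (f - g) = inv_q f - inv_q g"
  using inv_q_add[of "f - g" g] by (simp add: algebra_simps)

lemma inv_q_power: "inv_q (f ^ n) = inv_q f ^ n"
  by (induction n) (simp_all add: inv_q_1 inv_q_mult)

section \<open>Transformation of the equation of Omega\<close>

lemma inv_q_Omega:
  "Crls (\<lambda>T. (1 / qq) ^ tsize T * inv_q (Omega T)) bullet T - inv_q (Omega T) =
     graft_bullet (\<lambda>T. inv_q (Omega T)) T + (1 / qq - 1) * bullet T"
proof -
  have "is_Omega Omega" unfolding Omega_def using ex1_Omega by (rule theI')
  moreover have "tscale qq (suspension qq Omega) = (\<lambda>T. qq ^ tsize T * Omega T)"
    by (rule ext) (rule tscale_suspension)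
  ultimately have "Crls (\<lambda>T. qq ^ tsize T * Omega T) bullet T - Omega T =
      graft_bullet Omega T + (qq - 1) * bullet T"
    by (simp add: is_Omega_def tscale_def fun_eq_iff)
  then have "inv_q (Crls (\<lambda>T. qq ^ tsize T * Omega T) bullet T) - inv_q (Omega T) =
      inv_q (graft_bullet Omega T) + inv_q (qq - 1) * inv_q (bullet T)"
    by (metis inv_q_add inv_q_diff inv_q_mult)
  moreover have "inv_q (bullet T) = bullet T" by (simp add: bullet_def inv_q_0 inv_q_1)
  moreover have "inv_q (graft_bullet Omega T) = graft_bullet (\<lambda>T. inv_q (Omega T)) T"
    by (simp add: graft_bullet_def inv_q_0)
  moreover have "inv_q (Crls (\<lambda>T. qq ^ tsize T * Omega T) bullet T) =
      Crls (\<lambda>T. (1 / qq) ^ tsize T * inv_q (Omega T)) bullet T"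
    by (subst Crls_bullet_additive) (simp_all add: inv_q_add inv_q_mult inv_q_power inv_q_qq)
  ultimately show ?thesis by (simp add: inv_q_diff inv_q_qq inv_q_1)
qed

lemma is_Omega_bar_Omega_bar: "is_Omega_bar Omega_bar"
  unfolding is_Omega_bar_def
proof
  fix T
  let ?W = Omega_bar and ?U = "\<lambda>T. inv_q (Omega T)"
  \<comment> \<open>The suspension has exponent \<open>tsize T - 1\<close>; passing to the full
    power of -q costs the constant -1/q.\<close>
  have U: "?U T = - (1 / qq) * ((- qq) ^ tsize T * ?W T)" for T
  proof -
    obtain n where n: "tsize T = Suc n" using tsize_pos gr0_implies_Suc by blast
    have "(- qq) ^ n * (- 1 / qq) ^ n = 1" by (simp flip: power_mult_distrib)
    then show ?thesis by (simp add: Omega_bar_def suspension_def n)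
  qed
  have "(\<lambda>T. (1 / qq) ^ tsize T * ?U T) = (\<lambda>T. - (1 / qq) * ((- 1) ^ tsize T * ?W T))"
  proof
    fix T
    have "(1 / qq) ^ tsize T * (- qq) ^ tsize T = (- 1) ^ tsize T" by (simp flip: power_mult_distrib)
    then show "(1 / qq) ^ tsize T * ?U T = - (1 / qq) * ((- 1) ^ tsize T * ?W T)"
      unfolding U by (metis mult.assoc mult.left_commute)
  qed
  \<comment> \<open>The one-vertex tree has odd size, so the sign moves from the first argument of
    \<open>Crls\<close> into \<open>bullet\<close>.\<close>
  moreover have "bullet = (\<lambda>T. (- 1) ^ tsize T * (- bullet) T :: ratq)"
    by (auto simp: bullet_def tsize_one_vertex fun_Compl_def)
  then have "Crls (\<lambda>T. (- 1) ^ tsize T * ?W T) bullet T = (- 1) ^ tsize T * Crls ?W (- bullet) T"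
    by (rule ssubst) (rule Crls_power_tsize)
  ultimately have C: "Crls (\<lambda>T. (1 / qq) ^ tsize T * ?U T) bullet T =
      - (1 / qq) * ((- 1) ^ tsize T * Crls ?W (- bullet) T)"
    by (simp only: Crls_mult_left)
  \<comment> \<open>The sign is opposite to that in \<open>U\<close> because \<open>T\<close> has
    one vertex more than its branch.\<close>
  have gU: "graft_bullet ?U T = (1 / qq) * (- 1) ^ tsize T * graft_bullet (\<lambda>T. qq ^ tsize T * ?W T) T"
  proof (cases T rule: B_plus_single_cases)
    case (single T1)
    have "?U T1 = - (1 / qq) * ((- 1) ^ tsize T1 * (qq ^ tsize T1 * ?W T1))"
      unfolding U[of T1] by (simp add: power_minus[of qq])
    then show ?thesis by (simp add: single graft_bullet_B_plus tsize_B_plus_single)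
  qed (simp add: graft_bullet_def)
  have s: "(- 1) ^ tsize T * (- 1) ^ tsize T = (1::ratq)" by (simp flip: power_mult_distrib)
  have b: "(- 1) ^ tsize T * bullet T = - (bullet T :: ratq)" by (simp add: bullet_def tsize_one_vertex)
  define \<epsilon> K V g where "\<epsilon> = ((- 1) ^ tsize T :: ratq)" and "K = Crls ?W (- bullet) T"
    and "V = qq ^ tsize T * ?W T" and "g = graft_bullet (\<lambda>T. qq ^ tsize T * ?W T) T"
  have "?U T = - (1 / qq) * (\<epsilon> * V)"
    unfolding U[of T] \<epsilon>_def V_def by (simp add: power_minus[of qq])
  then have eq: "- (1 / qq) * (\<epsilon> * K) + (1 / qq) * (\<epsilon> * V) = (1 / qq) * \<epsilon> * g + (1 / qq - 1) * bullet T"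
    using inv_q_Omega[of T] C gU[folded \<epsilon>_def g_def] by (simp add: \<epsilon>_def K_def)
  \<comment> \<open>Multiplication by q \<epsilon> clears the signs: \<epsilon> squares to 1 and
    negates \<open>bullet T\<close>, which turns 1 - q into q - 1.\<close>
  have "\<epsilon> * \<epsilon> * (V - K) = qq * \<epsilon> * (- (1 / qq) * (\<epsilon> * K) + (1 / qq) * (\<epsilon> * V))"
    by (simp add: field_simps)
  also have "\<dots> = \<epsilon> * \<epsilon> * g + (1 - qq) * (\<epsilon> * bullet T)"
    unfolding eq by (simp add: field_simps)
  finally have "V - K = (qq - 1) * bullet T + g"
    using s b unfolding \<epsilon>_def[symmetric] by (simp add: algebra_simps)
  then show "qq ^ tsize T * ?W T - Crls ?W (- bullet) T =
      (qq - 1) * bullet T + graft_bullet (\<lambda>T. qq ^ tsize T * ?W T) T"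
    unfolding V_def K_def g_def .
qed

theorem mainTheorem5:
  fixes Ts :: "rtree list"
  shows "Omega_bar (B_plus Ts) = Psi (\<Prod>T\<leftarrow>Ts. S_series T)"
  using is_Omega_bar_unique[OF is_Omega_bar_Omega_bar is_Omega_bar_Psi_S]
  by (simp add: Psi_S_def Crls_bullet_B_plus)

end
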